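(* Let $\kappa$ be a regular uncountable cardinal and $\chi<\kappa$ an infinite regular cardinal, and suppose that $\square(\kappa,{\sqsubseteq_\chi})$ holds. Then for every fat subset $F\subseteq\kappa$ there exists a partition $\langle F_j\mid j<\kappa\rangle$ of $F$ such that: (1) $F_j$ is fat for every $j<\kappa$; (2) for every $J\subseteq\kappa$, there is no $\delta\in E^\kappa_{\ge\chi}$ of uncountable cofinality such that both $(\bigcup_{j\in J}F_j)\cap\delta$ and $(\bigcup_{j\in\kappa\setminus J}F_j)\cap\delta$ are stationary in $\delta$.
   Context: $E^\kappa_{\ge\chi}=\{\alpha<\kappa\mid \mathrm{cf}(\alpha)\ge\chi\}$. A set $F\subseteq\kappa$ is fat if for every club $D\subseteq\kappa$ and every infinite regular cardinal $\theta<\kappa$, there is a strictly increasing continuous map $\pi:\theta+1\to F\cap D$. For a set of ordinals $C$: $\mathrm{acc}(C)=\{\alpha\in C\mid\sup(C\cap\alpha)=\alpha>0\}$, $\mathrm{nacc}(C)=C\setminus\mathrm{acc}(C)$, $\mathrm{acc}^+(C)=\{\alpha<\sup(C)\mid\sup(C\cap\alpha)=\alpha>0\}$. $D\sqsubseteq C$ means $D=C\cap\beta$ for some ordinal $\beta$; $D\sqsubseteq_\chi C$ means $D\sqsubseteq C$, or ($\mathrm{otp}(C)<\chi$ and $\mathrm{nacc}(C)$ consists only of successor ordinals). $\square(\kappa,{\sqsubseteq_\chi})$ asserts the existence of a sequence $\langle\mathcal C_\alpha\mid\alpha<\kappa\rangle$ where: $\mathcal C_0=\{\emptyset\}$, $\mathcal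 C_{\alpha+1}=\{\{\alpha\}\}$; for limit $\alpha$, $\mathcal C_\alpha$ is a set of exactly one club subset of $\alpha$; for every $\alpha$, $C\in\mathcal C_\alpha$ and $\bar\alpha\in\mathrm{acc}(C)$ there is $D\in\mathcal C_{\bar\alpha}$ with $D\sqsubseteq_\chi C$; for every cofinal $A\subseteq\kappa$ there is $\alpha\in\mathrm{acc}^+(A)$ with $A\cap\alpha\notin\mathcal C_\alpha$; letting $\Gamma=\{\alpha\in\mathrm{acc}(\kappa)\mid\forall C\in\mathcal C_\alpha\forall\bar\alpha\in\mathrm{acc}(C)\,[C\cap\bar\alpha\in\mathcal C_{\bar\alpha}]\}$, for every limit $\alpha\notin\Gamma$ the unique element of $\mathcal C_\alpha$ has order-type $\mathrm{cf}(\alpha)$; and every ordinal of countable cofinality below $\kappa$ is in $\Gamma$. *)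

theory Defs
  imports "HOL-Library.Countable_Set" "HOL-Library.Disjoint_Sets"
begin

unbundle cardinal_syntax

text \<open>
  The cardinal \<open>\<kappa>\<close> is represented by a type \<open>'k :: wellorder\<close> whose order is required to be a
  regular uncountable cardinal. The elements of \<open>'k\<close> are the ordinals below \<open>\<kappa>\<close>, the ordinal
  \<open>\<alpha> < \<kappa>\<close> viewed as a set is \<open>{..<\<alpha>}\<close>, and \<open>\<kappa>\<close> itself as a set is \<open>UNIV\<close>.
  Order types are compared with the library relations \<open>=o\<close> and \<open><o\<close> on well-orders.
\<close>

definition le_on :: "'k::wellorder set \<Rightarrow> 'k rel" where
  "le_on A = {(x, y). x \<in> A \<and> y \<in> A \<and> x \<le> y}"

text \<open>For \<open>A = {..<\<theta>}\<close> or \<open>A = UNIV\<close>: the ordinal \<open>\<theta>\<close>, respectively \<open>\<kappa>\<close>, is an infinite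
  regular cardinal.\<close>

definition infinite_regular :: "'k::wellorder set \<Rightarrow> bool" where
  "infinite_regular A \<longleftrightarrow> infinite A \<and> Card_order (le_on A) \<and> regularCard (le_on A)"

definition ord_zero :: "'k::wellorder" where
  "ord_zero = (LEAST x. True)"

definition ord_suc :: "'k::wellorder \<Rightarrow> 'k" where
  "ord_suc \<alpha> = (LEAST x. \<alpha> < x)"

definition ord_omega :: "'k::wellorder" where
  "ord_omega = (LEAST x. infinite {..<x})"

text \<open>Only meaningful for sets bounded in \<open>\<kappa>\<close>; in particular \<open>ord_sup {} = ord_zero\<close>.\<close>

definition ord_sup :: "'k::wellorder set \<Rightarrow> 'k" where
  "ord_sup A = (LEAST x. \<forall>a\<in>A. a \<le> x)"

definition cf :: "'k::wellorder \<Rightarrow> 'k" where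
  "cf \<alpha> = (LEAST \<theta>. \<exists>f. f ` {..<\<theta>} \<subseteq> {..<\<alpha>} \<and> (\<forall>\<beta><\<alpha>. \<exists>i<\<theta>. \<beta> \<le> f i))"

definition E_ge :: "'k::wellorder \<Rightarrow> 'k set" where
  "E_ge \<chi> = {\<alpha>. \<chi> \<le> cf \<alpha>}"

definition accum :: "'k::wellorder set \<Rightarrow> 'k set" where
  "accum C = {\<alpha> \<in> C. ord_sup (C \<inter> {..<\<alpha>}) = \<alpha> \<and> ord_zero < \<alpha>}"

definition naccum :: "'k::wellorder set \<Rightarrow> 'k set" where
  "naccum C = C - accum C"

text \<open>The condition \<open>\<alpha> < sup C\<close> is written as \<open>\<exists>\<beta>\<in>C. \<alpha> < \<beta>\<close>, so that it also covers
  \<open>sup C = \<kappa>\<close>.\<close>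

definition accum_plus :: "'k::wellorder set \<Rightarrow> 'k set" where
  "accum_plus C =
    {\<alpha>. (\<exists>\<beta>\<in>C. \<alpha> < \<beta>) \<and> ord_sup (C \<inter> {..<\<alpha>}) = \<alpha> \<and> ord_zero < \<alpha>}"

text \<open>The limit ordinals below \<open>\<kappa>\<close>, i.e. \<open>acc(\<kappa>)\<close>, are \<open>accum UNIV\<close>.\<close>

text \<open>Used for \<open>X = UNIV\<close> (club in \<open>\<kappa>\<close>) and for \<open>X = {..<\<delta>}\<close> with \<open>\<delta>\<close> a limit ordinal
  (club in \<open>\<delta>\<close>). Since \<open>C\<close> is cofinal in \<open>X\<close>, \<open>accum_plus C\<close> consists of all limits of \<open>C\<close>
  inside \<open>X\<close>.\<close>

definition club_in :: "'k::wellorder set \<Rightarrow> 'k set \<Rightarrow> bool" where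
  "club_in C X \<longleftrightarrow> C \<subseteq> X \<and> cofinal C (le_on X) \<and> accum_plus C \<subseteq> C"

definition stationary_in :: "'k::wellorder set \<Rightarrow> 'k \<Rightarrow> bool" where
  "stationary_in S \<delta> \<longleftrightarrow> S \<subseteq> {..<\<delta>} \<and> (\<forall>C. club_in C {..<\<delta>} \<longrightarrow> S \<inter> C \<noteq> {})"

text \<open>The map \<open>\<pi>\<close> is only constrained on \<open>\<theta> + 1 = {..\<theta>}\<close>.\<close>

definition fat :: "'k::wellorder set \<Rightarrow> bool" where
  "fat F \<longleftrightarrow> (\<forall>D. \<forall>\<theta>::'k. club_in D UNIV \<longrightarrow> infinite_regular {..<\<theta>} \<longrightarrow>
    (\<exists>\<pi>. \<pi> ` {..\<theta>} \<subseteq> F \<inter> D \<and> strict_mono_on {..\<theta>} \<pi> \<and>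
         (\<forall>\<delta>\<le>\<theta>. \<delta> \<in> accum UNIV \<longrightarrow> \<pi> \<delta> = ord_sup (\<pi> ` {..<\<delta>}))))"

text \<open>\<open>D = C \<inter> \<beta>\<close> for some ordinal \<open>\<beta>\<close>; the disjunct \<open>D = C\<close> accounts for \<open>\<beta> \<ge> \<kappa>\<close>.\<close>

definition init_seg :: "'k::wellorder set \<Rightarrow> 'k set \<Rightarrow> bool" where
  "init_seg D C \<longleftrightarrow> D = C \<or> (\<exists>\<beta>. D = C \<inter> {..<\<beta>})"

definition init_seg_mod :: "'k::wellorder \<Rightarrow> 'k set \<Rightarrow> 'k set \<Rightarrow> bool" where
  "init_seg_mod \<chi> D C \<longleftrightarrow>
    init_seg D C \<or> (le_on C <o le_on {..<\<chi>} \<and> naccum C \<subseteq> range ord_suc)"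

definition Gamma :: "('k::wellorder \<Rightarrow> 'k set set) \<Rightarrow> 'k set" where
  "Gamma \<C> = {\<alpha> \<in> accum UNIV. \<forall>C\<in>\<C> \<alpha>. \<forall>\<beta>\<in>accum C. C \<inter> {..<\<beta>} \<in> \<C> \<beta>}"

definition square_sequence :: "'k::wellorder \<Rightarrow> ('k \<Rightarrow> 'k set set) \<Rightarrow> bool" where
  "square_sequence \<chi> \<C> \<longleftrightarrow>
    \<C> ord_zero = {{}} \<and>
    (\<forall>\<alpha>. \<C> (ord_suc \<alpha>) = {{\<alpha>}}) \<and>
    (\<forall>\<alpha>\<in>accum UNIV. \<exists>C. \<C> \<alpha> = {C} \<and> club_in C {..<\<alpha>}) \<and>
    (\<forall>\<alpha>. \<forall>C\<in>\<C> \<alpha>. \<forall>\<beta>\<in>accum C. \<exists>D\<in>\<C> \<beta>. init_seg_mod \<chi> D C) \<and>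
    (\<forall>A. cofinal A (le_on UNIV) \<longrightarrow> (\<exists>\<alpha>\<in>accum_plus A. A \<inter> {..<\<alpha>} \<notin> \<C> \<alpha>)) \<and>
    (\<forall>\<alpha>\<in>accum UNIV - Gamma \<C>. \<forall>C\<in>\<C> \<alpha>. le_on C =o le_on {..<cf \<alpha>}) \<and>
    (\<forall>\<alpha>. cf \<alpha> = ord_omega \<longrightarrow> \<alpha> \<in> Gamma \<C>)"

definition square_principle :: "'k::wellorder \<Rightarrow> bool" where
  "square_principle \<chi> \<longleftrightarrow> (\<exists>\<C>. square_sequence \<chi> \<C>)"

end

theory Submission
  imports Defs
begin

text \<open>
  Let \<open>c \<delta>\<close> be the club assigned to the limit \<open>\<delta>\<close> and colour \<open>\<delta>\<close> by
  \<open>h\<^sub>i \<delta> = min (c \<delta> - (i + 1))\<close>. If \<open>cf \<delta> \<ge> \<chi>\<close>, the sequence is fully coherent below \<open>\<delta>\<close>, so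
  \<open>h\<^sub>i\<close> is constant on a tail of the accumulation points of \<open>c \<delta>\<close>; hence any partition into
  unions of colour classes satisfies (2). For regular \<open>\<theta> \<ge> \<chi>\<close> let \<open>S\<^sub>\<theta>\<close> be the stationary set of
  suprema of closed copies of \<open>\<theta>\<close> in \<open>F\<close> that lie in \<open>F\<close>. If \<open>S\<^sub>\<theta>\<close> meets a colour class
  stationarily, then intersecting such a copy with the accumulation points of \<open>c \<delta>\<close> shows that
  the part of \<open>F\<close> in that class has closed copies of \<open>\<theta> + 1\<close> in every club (for \<open>\<theta> = \<omega>\<close>, where no
  continuity below the top is required, its stationarity suffices).

  It remains to find one \<open>i\<close> such that for every \<open>\<theta>\<close> unboundedly many colours are stationary in
  some \<open>S\<^sub>\<theta>\<^sub>'\<close> with \<open>\<theta>' \<ge> \<theta>\<close>; these colours are then redistributed so that every class receives one for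
  each \<open>\<theta>\<close>. If no \<open>i\<close> works, Fodor's lemma bounds \<open>h\<^sub>i\<close> by some \<open>g i\<close> almost everywhere, the
  closure points \<open>\<epsilon>\<close> of \<open>g\<close> become accumulation points of \<open>c \<delta>\<close>, and the sets \<open>c \<epsilon>\<close> cohere to a
  thread.
\<close>

subsection \<open>Limits, clubs and regular cardinals\<close>

definition limit_of :: "'k::wellorder set \<Rightarrow> 'k \<Rightarrow> bool" where
  "limit_of C \<alpha> \<longleftrightarrow> ord_zero < \<alpha> \<and> (\<forall>x<\<alpha>. \<exists>c\<in>C. x < c \<and> c < \<alpha>)"

lemma ord_sup_eqI:
  assumes "\<And>a. a \<in> A \<Longrightarrow> a \<le> s" and "\<And>x. x < s \<Longrightarrow> \<exists>a\<in>A. x < a"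
  shows "ord_sup A = s"
  unfolding ord_sup_def
  by (rule Least_equality) (use assms in \<open>force simp: not_le[symmetric]\<close>)+

lemma less_ord_supD:
  assumes "x < ord_sup A"
  shows "\<exists>a\<in>A. x < a"
  using not_less_Least[OF assms[unfolded ord_sup_def]] by (auto simp: not_le)

lemma limit_of_iff: "limit_of C \<alpha> \<longleftrightarrow> ord_sup (C \<inter> {..<\<alpha>}) = \<alpha> \<and> ord_zero < \<alpha>"
proof
  assume "limit_of C \<alpha>"
  then show "ord_sup (C \<inter> {..<\<alpha>}) = \<alpha> \<and> ord_zero < \<alpha>"
    by (auto simp: limit_of_def intro!: ord_sup_eqI)
next
  assume "ord_sup (C \<inter> {..<\<alpha>}) = \<alpha> \<and> ord_zero < \<alpha>"
  then show "limit_of C \<alpha>"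
    using less_ord_supD[of _ "C \<inter> {..<\<alpha>}"] by (auto simp: limit_of_def)
qed

lemma ord_zero_le: "ord_zero \<le> x"
  unfolding ord_zero_def by (rule Least_le) simp

lemma accum_iff: "\<alpha> \<in> accum C \<longleftrightarrow> \<alpha> \<in> C \<and> limit_of C \<alpha>"
  by (auto simp: accum_def limit_of_iff)

lemma limit_of_mono: "limit_of C \<alpha> \<Longrightarrow> C \<subseteq> D \<Longrightarrow> limit_of D \<alpha>"
  unfolding limit_of_def by blast

lemma limit_of_less: "limit_of C \<alpha> \<Longrightarrow> x < \<alpha> \<Longrightarrow> \<exists>c\<in>C. x < c \<and> c < \<alpha>"
  by (auto simp: limit_of_def)

lemma limit_ofI: "x < \<alpha> \<Longrightarrow> (\<And>x. x < \<alpha> \<Longrightarrow> \<exists>c\<in>C. x < c \<and> c < \<alpha>) \<Longrightarrow> limit_of C \<alpha>"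
  unfolding limit_of_def using ord_zero_le le_less_trans by blast

lemma limit_of_iterate:
  assumes "limit_of {\<beta>. limit_of C \<beta>} \<alpha>"
  shows "limit_of C \<alpha>"
proof -
  have "\<exists>c\<in>C. x < c \<and> c < \<alpha>" if x: "x < \<alpha>" for x
  proof -
    obtain \<beta> where "limit_of C \<beta>" "x < \<beta>" "\<beta> < \<alpha>" using limit_of_less[OF assms x] by auto
    then show ?thesis by (meson limit_of_less order.strict_trans)
  qed
  then show ?thesis using assms by (auto simp: limit_of_def)
qed

lemma Field_le_on [simp]: "Field (le_on A) = A"
  by (auto simp: le_on_def Field_def)

lemma cofinal_le_on_iff:
  "cofinal C (le_on X) \<longleftrightarrow> (\<forall>x\<in>X. \<exists>c\<in>C \<inter> X. x < c)"
  unfolding cofinal_def Field_le_on by (auto simp: le_on_def order.strict_iff_order)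

text \<open>Covers both \<kappa> itself, as \<open>UNIV\<close>, and the segments below its points,
  so that facts on clubs and closure points are proved once for both.\<close>

definition lower :: "'k::wellorder set \<Rightarrow> bool" where
  "lower L \<longleftrightarrow> (\<forall>x\<in>L. \<forall>y\<le>x. y \<in> L)"

lemma lower_UNIV [simp]: "lower UNIV" and lower_lessThan [simp]: "lower {..<\<delta>}"
  by (auto simp: lower_def)

lemma lowerD: "lower L \<Longrightarrow> x \<in> L \<Longrightarrow> y \<le> x \<Longrightarrow> y \<in> L"
  by (auto simp: lower_def)

text \<open>\<open>accum_plus\<close> asks for an element of \<open>C\<close> above \<alpha>; for
  \<open>C\<close> unbounded in a downward closed \<open>L\<close> this amounts to
  \<open>\<alpha> \<in> L\<close>.\<close>

lemma club_in_iff: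
  assumes "lower L"
  shows "club_in C L \<longleftrightarrow> C \<subseteq> L \<and> (\<forall>x\<in>L. \<exists>c\<in>C. x < c) \<and> (\<forall>\<alpha>\<in>L. limit_of C \<alpha> \<longrightarrow> \<alpha> \<in> C)"
proof -
  have *: "\<alpha> \<in> accum_plus C \<longleftrightarrow> \<alpha> \<in> L \<and> limit_of C \<alpha>"
    if "C \<subseteq> L" "\<forall>x\<in>L. \<exists>c\<in>C. x < c" for \<alpha>
    using that lowerD[OF assms, of _ \<alpha>] by (fastforce simp: accum_plus_def limit_of_iff)
  show ?thesis unfolding club_in_def cofinal_le_on_iff using * by blast
qed

section \<open>Uncountable cofinality and closure points\<close>

definition uncountable_cofinality :: "'k::wellorder set \<Rightarrow> bool" where
  "uncountable_cofinality L \<longleftrightarrow> (\<forall>f::nat \<Rightarrow> 'k. range f \<subseteq> L \<longrightarrow> (\<exists>b\<in>L. \<forall>n. f n < b))"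

text \<open>Iterate a choice of \<open>R\<close>-successors \<omega> times from \<beta> and let
  \<gamma> be the least strict bound of the iterates. Any \<open>x < \<gamma>\<close> is at most
  some iterate, and monotonicity passes the next step on to \<open>x\<close>. A conjunction as
  \<open>R\<close> yields simultaneous limits of several sets.\<close>

lemma closure_point:
  assumes "uncountable_cofinality L" and "lower L"
    and R: "\<And>x. x \<in> L \<Longrightarrow> \<exists>z\<in>L. R x z"
    and mono: "\<And>x y z. x \<le> y \<Longrightarrow> R y z \<Longrightarrow> R x z"
    and less: "\<And>x z. R x z \<Longrightarrow> x < z"
    and "\<beta> \<in> L"
  shows "\<exists>\<gamma>\<in>L. \<beta> < \<gamma> \<and> (\<forall>x<\<gamma>. \<exists>z<\<gamma>. R x z)"
proof -
  obtain s where s: "\<And>x. x \<in> L \<Longrightarrow> s x \<in> L \<and> R x (s x)" using R by metis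
  define f where "f n = (s ^^ n) \<beta>" for n
  have fL: "f n \<in> L" for n by (induction n) (use s assms in \<open>auto simp: f_def\<close>)
  have fR: "R (f n) (f (Suc n))" for n using s[OF fL[of n]] by (simp add: f_def)
  define \<gamma> where "\<gamma> = (LEAST b. \<forall>n. f n < b)"
  obtain b where b: "b \<in> L" "\<forall>n. f n < b"
    using assms(1) fL unfolding uncountable_cofinality_def by (metis image_subsetI)
  have \<gamma>: "f n < \<gamma>" for n using LeastI[of "\<lambda>b. \<forall>n. f n < b", OF b(2)] by (simp add: \<gamma>_def)
  have "\<gamma> \<le> b" unfolding \<gamma>_def by (rule Least_le) (use b in auto)
  then have "\<gamma> \<in> L" using b lowerD[OF assms(2)] by blast
  moreover have "\<beta> < \<gamma>" using \<gamma>[of 0] by (simp add: f_def)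
  moreover have "\<exists>z<\<gamma>. R x z" if x: "x < \<gamma>" for x
  proof -
    obtain n where "x \<le> f n" using not_less_Least[of x "\<lambda>b. \<forall>n. f n < b"] x by (auto simp: \<gamma>_def not_less)
    then show ?thesis using mono fR \<gamma> by blast
  qed
  ultimately show ?thesis by blast
qed

section \<open>Small subsets of regular cardinals are bounded\<close>

lemma infinite_regular_bounded:
  assumes reg: "infinite_regular A" and K: "K \<subseteq> A" "|K| <o |A|"
  shows "\<exists>b\<in>A. \<forall>k\<in>K. k < b"
proof -
  have co: "Card_order (le_on A)" "regularCard (le_on A)" "infinite A"
    using reg by (auto simp: infinite_regular_def)
  have iso: "|A| =o le_on A" using card_of_Field_ordIso[OF co(1)] by simp
  have "\<not> cofinal K (le_on A)"
  proof
    assume "cofinal K (le_on A)"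
    then have "|K| =o le_on A" using co(2) K(1) by (simp add: regularCard_def)
    then show False
      using K(2) iso not_ordLess_ordIso ordIso_symmetric ordIso_transitive by metis
  qed
  then obtain x where x: "x \<in> A" "\<And>k. k \<in> K \<Longrightarrow> \<not> x < k"
    using K(1) by (auto simp: cofinal_le_on_iff)
  \<comment> \<open>Non-cofinality gives only a weak bound \<open>x\<close>; an infinite cardinal
    has no maximum, so a strict one exists above it.\<close>
  obtain y where "y \<in> A" "x < y"
    using infinite_Card_order_limit[OF co(1), of x, unfolded Field_le_on] co(3) x(1)
    by (auto simp: le_on_def order.strict_iff_order)
  then show ?thesis using x(2) by (metis le_less_trans not_le)
qed

lemma infinite_regular_segment:
  assumes reg: "infinite_regular A" "lower A" and "x \<in> A"
  shows "|{..<x}| <o |A|"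
proof -
  have co: "Card_order (le_on A)" using reg by (auto simp: infinite_regular_def)
  have iso: "le_on A =o |A|" using card_of_Field_ordIso[OF co(1)] by (simp add: ordIso_symmetric)
  have "underS (le_on A) x = {..<x}"
    using assms lowerD[OF assms(2,3)] by (auto simp: underS_def le_on_def)
  then show ?thesis using card_of_underS[OF co(1), of x] assms(3) iso ordLess_ordIso_trans by fastforce
qed

lemma infinite_regular_bounded_image:
  assumes reg: "infinite_regular A" "lower A" and "x \<in> A" and "\<And>y. y < x \<Longrightarrow> f y \<in> A"
  shows "\<exists>b\<in>A. \<forall>y<x. f y < b"
proof -
  have "|f ` {..<x}| <o |A|"
    using infinite_regular_segment[OF assms(1-3)] card_of_image ordLeq_ordLess_trans by blast
  then obtain b where "b \<in> A" "\<forall>k\<in>f ` {..<x}. k < b"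
    using infinite_regular_bounded[OF reg(1), of "f ` {..<x}"] assms(4) by auto
  then show ?thesis by auto
qed

lemma infinite_regular_greater:
  assumes "infinite_regular A" "x \<in> A"
  shows "\<exists>y\<in>A. x < y"
proof -
  have "|{x}| <o |A|"
    using assms by (intro finite_ordLess_infinite) (auto simp: infinite_regular_def Field_card_of card_of_well_order_on)
  then show ?thesis using infinite_regular_bounded[OF assms(1), of "{x}"] assms(2) by auto
qed

lemma infinite_regular_uncountable_cofinality:
  assumes "infinite_regular A" "uncountable A"
  shows "uncountable_cofinality A"
  unfolding uncountable_cofinality_def
proof (intro allI impI)
  fix f :: "nat \<Rightarrow> 'a" assume f: "range f \<subseteq> A"
  have "\<not> |A| \<le>o |range f|"
    using assms(2) by (metis countable_image countableI_type card_of_ordLeq countable_image_inj_on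
        countable_subset)
  then have "|range f| <o |A|" by (simp add: not_ordLeq_iff_ordLess card_of_Well_order)
  from infinite_regular_bounded[OF assms(1) f this] show "\<exists>b\<in>A. \<forall>n. f n < b" by auto
qed


subsection \<open>Stationary sets\<close>

text \<open>Stationarity in \<kappa> itself; \<open>stationary_in\<close> speaks only of points
  below \<kappa>.\<close>

definition stationary :: "'k::wellorder set \<Rightarrow> bool" where
  "stationary S \<longleftrightarrow> (\<forall>D. club_in D UNIV \<longrightarrow> S \<inter> D \<noteq> {})"

lemma stationary_mono: "stationary S \<Longrightarrow> S \<subseteq> T \<Longrightarrow> stationary T"
  unfolding stationary_def by blast

context
  assumes reg: "infinite_regular (UNIV :: 'k::wellorder set)"
begin

lemma bounded_on_segment: "\<exists>b::'k. \<forall>y<x. f y < b" for x :: 'k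
  using infinite_regular_bounded_image[OF reg lower_UNIV, of x f] by blast

lemma exists_greater: "\<exists>y. (x::'k) < y"
  using infinite_regular_greater[OF reg UNIV_I[of x]] by blast

lemma bounded_on_closed_segment: "\<exists>b::'k. \<forall>y\<le>x. f y < b" for x :: 'k
proof -
  obtain x' where "x < x'" using exists_greater by blast
  then show ?thesis using bounded_on_segment[of x' f] le_less_trans by blast
qed

context
  assumes unc: "uncountable (UNIV :: 'k set)"
begin

lemma closure_point_UNIV:
  fixes \<beta> :: 'k
  assumes "\<And>x. \<exists>z. R x z"
    and "\<And>x y z. x \<le> y \<Longrightarrow> R y z \<Longrightarrow> R x z" and "\<And>x z. R x z \<Longrightarrow> x < z"
  shows "\<exists>\<gamma>>\<beta>. \<forall>x<\<gamma>. \<exists>z<\<gamma>. R x z"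
proof -
  have "\<exists>\<gamma>\<in>UNIV. \<beta> < \<gamma> \<and> (\<forall>x<\<gamma>. \<exists>z<\<gamma>. R x z)"
  proof (rule closure_point[OF infinite_regular_uncountable_cofinality[OF reg unc] lower_UNIV])
    show "\<exists>z\<in>UNIV. R x z" for x using assms(1) by blast
  qed (fact assms UNIV_I)+
  then show ?thesis by blast
qed

section \<open>Diagonal intersections and Fodor's lemma\<close>

lemma club_in_UNIV_iff:
  "club_in C (UNIV :: 'k set) \<longleftrightarrow> (\<forall>x. \<exists>c\<in>C. x < c) \<and> (\<forall>\<alpha>. limit_of C \<alpha> \<longrightarrow> \<alpha> \<in> C)"
  by (simp add: club_in_iff)

text \<open>Taking limits of \<open>C i\<close> instead of its members makes the set closed for
  merely unbounded \<open>C i\<close>. For unboundedness, regularity gives one step from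
  \<open>x\<close> past an element of every \<open>C i\<close> with \<open>i \<le> x\<close>, and
  closure points of this step belong to the set.\<close>

lemma club_diagonal:
  fixes C :: "'k \<Rightarrow> 'k set"
  assumes "\<And>i x. \<exists>c\<in>C i. x < c"
  shows "club_in {\<gamma>. \<forall>i<\<gamma>. limit_of (C i) \<gamma>} UNIV"
  unfolding club_in_UNIV_iff
proof (intro conjI allI impI)
  fix \<beta> :: 'k
  obtain s where s: "\<And>i x. s i x \<in> C i \<and> x < s i x" using assms by metis
  let ?R = "\<lambda>x z. x < z \<and> (\<forall>i\<le>x. \<exists>c\<in>C i. x < c \<and> c < z)"
  have "\<exists>z. ?R x z" for x
  proof -
    obtain b where b: "\<forall>i\<le>x. s i x < b" using bounded_on_closed_segment[of x "\<lambda>i. s i x"] by blast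
    have "x < b" using b s[of x x] by force
    then have "?R x b" using b s by blast
    then show ?thesis ..
  qed
  moreover have "?R x z" if "x \<le> y" "?R y z" for x y z
    using that by (meson le_less_trans order_trans)
  ultimately obtain \<gamma> where \<gamma>: "\<beta> < \<gamma>" "\<forall>x<\<gamma>. \<exists>z<\<gamma>. ?R x z"
    using closure_point_UNIV[of ?R \<beta>] by blast
  have "limit_of (C i) \<gamma>" if i: "i < \<gamma>" for i
  proof (rule limit_ofI[OF i])
    fix x assume "x < \<gamma>"
    \<comment> \<open>The step from \<open>max i x\<close> takes care of the index \<open>i\<close>
      and stays above \<open>x\<close>.\<close>
    then have "max i x < \<gamma>" using i by simp
    then obtain z where z: "z < \<gamma>" "?R (max i x) z" using \<gamma>(2) by blast
    then obtain c where "c \<in> C i" "max i x < c" "c < z" using max.cobounded1[of i x] by blast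
    then show "\<exists>c\<in>C i. x < c \<and> c < \<gamma>" using z(1) by (intro bexI[of _ c]) auto
  qed
  then show "\<exists>c\<in>{\<gamma>. \<forall>i<\<gamma>. limit_of (C i) \<gamma>}. \<beta> < c" using \<gamma>(1) by blast
next
  fix \<alpha> assume \<alpha>: "limit_of {\<gamma>. \<forall>i<\<gamma>. limit_of (C i) \<gamma>} \<alpha>"
  have "limit_of (C i) \<alpha>" if i: "i < \<alpha>" for i
  proof (rule limit_ofI[OF i])
    fix x assume "x < \<alpha>"
    then have "max i x < \<alpha>" using i by simp
    then obtain \<gamma> where \<gamma>: "\<forall>i<\<gamma>. limit_of (C i) \<gamma>" "max i x < \<gamma>" "\<gamma> < \<alpha>"
      using limit_of_less[OF \<alpha>, of "max i x"] by blast
    then obtain c where "c \<in> C i" "x < c" "c < \<gamma>" using limit_of_less[of "C i" \<gamma> x] by auto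
    then show "\<exists>c\<in>C i. x < c \<and> c < \<alpha>" using \<gamma> by (intro bexI[of _ c]) auto
  qed
  then show "\<alpha> \<in> {\<gamma>. \<forall>i<\<gamma>. limit_of (C i) \<gamma>}" by blast
qed

lemma club_greaterThan: "club_in {x<..} (UNIV :: 'k set)"
  unfolding club_in_UNIV_iff
proof (intro conjI allI impI)
  fix y
  obtain z where "max x y < z" using exists_greater by blast
  then show "\<exists>c\<in>{x<..}. y < c" by auto
next
  fix \<alpha> assume "limit_of {x<..} \<alpha>"
  then obtain c where "c \<in> {x<..}" "c < \<alpha>" unfolding limit_of_def by blast
  then show "\<alpha> \<in> {x<..}" by auto
qed

text \<open>The diagonal intersection of a constant family; its condition is not vacuous at points
  above some \<open>x\<close>.\<close>

lemma club_limits: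
  assumes "\<And>x::'k. \<exists>c\<in>X. x < c"
  shows "club_in {\<gamma>. limit_of X \<gamma>} UNIV"
proof -
  have "\<exists>\<gamma>>x. limit_of X \<gamma>" for x
  proof -
    obtain y where "x < y" using exists_greater by blast
    moreover have "club_in {\<gamma>. \<forall>i<\<gamma>. limit_of X \<gamma>} UNIV" using club_diagonal[of "\<lambda>_. X"] assms by simp
    ultimately show ?thesis unfolding club_in_UNIV_iff by blast
  qed
  then show ?thesis
    unfolding club_in_UNIV_iff using limit_of_iterate by blast
qed

text \<open>The diagonal intersection of the family that is \<open>C\<close> at index zero and
  \<open>D\<close> elsewhere. Points above some nonzero \<open>y\<close> see both indices, so they
  are limits of both sets.\<close>

lemma club_Int:
  assumes "club_in C (UNIV :: 'k set)" "club_in D UNIV"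
  shows "club_in (C \<inter> D) UNIV"
proof -
  let ?C = "\<lambda>i. if i = ord_zero then C else D"
  have "club_in {\<gamma>. \<forall>i<\<gamma>. limit_of (?C i) \<gamma>} UNIV"
    by (rule club_diagonal) (use assms in \<open>auto simp: club_in_UNIV_iff\<close>)
  then have diag: "\<exists>\<gamma>. x < \<gamma> \<and> (\<forall>i<\<gamma>. limit_of (?C i) \<gamma>)" for x
    unfolding club_in_UNIV_iff by blast
  have unbounded: "\<exists>\<gamma>>x. limit_of C \<gamma> \<and> limit_of D \<gamma>" for x
  proof -
    obtain y :: 'k where y: "ord_zero < y" using exists_greater by blast
    obtain \<gamma> where \<gamma>: "max x y < \<gamma>" "\<And>i. i < \<gamma> \<Longrightarrow> limit_of (?C i) \<gamma>" using diag by blast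
    have "y \<noteq> ord_zero" "ord_zero < \<gamma>" "y < \<gamma>" "x < \<gamma>" using y \<gamma>(1) by auto
    then show ?thesis using \<gamma>(2)[of ord_zero] \<gamma>(2)[of y] by auto
  qed
  have "\<gamma> \<in> C \<inter> D" if "limit_of C \<gamma>" "limit_of D \<gamma>" for \<gamma>
    using that assms unfolding club_in_UNIV_iff by blast
  moreover have "limit_of C \<gamma> \<and> limit_of D \<gamma>" if "limit_of (C \<inter> D) \<gamma>" for \<gamma>
    using limit_of_mono[OF that inf_le1] limit_of_mono[OF that inf_le2] by blast
  ultimately show ?thesis using unbounded unfolding club_in_UNIV_iff by meson
qed

lemma stationary_Int_club: "stationary S \<Longrightarrow> club_in D UNIV \<Longrightarrow> stationary (S \<inter> D :: 'k set)"
  unfolding stationary_def by (metis club_Int Int_assoc)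

lemma stationary_Collect_greater:
  "stationary S \<Longrightarrow> stationary {\<delta>\<in>S. (x::'k) < \<delta>}"
  by (rule stationary_mono[OF stationary_Int_club[OF _ club_greaterThan[of x]]]) auto

lemma stationary_cofinal: "stationary S \<Longrightarrow> \<exists>\<delta>\<in>S. (x::'k) < \<delta>"
  using club_greaterThan[of x] by (auto simp: stationary_def)

text \<open>If every fibre missed a club \<open>C \<tau>\<close>, some \<delta> in \<open>S\<close>
  would be a limit of all \<open>C i\<close> with \<open>i < \<delta>\<close>, in particular a
  member of \<open>C (f \<delta>)\<close>, which its own fibre avoids.\<close>

lemma fodor:
  fixes f :: "'k \<Rightarrow> 'k"
  assumes "stationary S" and regressive: "\<And>\<delta>. \<delta> \<in> S \<Longrightarrow> f \<delta> < \<delta>"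
  shows "\<exists>\<tau>. stationary {\<delta>\<in>S. f \<delta> = \<tau>}"
proof (rule ccontr)
  assume "\<nexists>\<tau>. stationary {\<delta>\<in>S. f \<delta> = \<tau>}"
  then have "\<exists>C. \<forall>\<tau>. club_in (C \<tau>) UNIV \<and> {\<delta>\<in>S. f \<delta> = \<tau>} \<inter> C \<tau> = {}"
    unfolding stationary_def by metis
  then obtain C where C: "\<And>\<tau>. club_in (C \<tau>) UNIV" "\<And>\<tau>. {\<delta>\<in>S. f \<delta> = \<tau>} \<inter> C \<tau> = {}"
    by blast
  have "club_in {\<gamma>. \<forall>i<\<gamma>. limit_of (C i) \<gamma>} UNIV"
    using club_diagonal[of C] C(1) by (auto simp: club_in_UNIV_iff)
  then obtain \<delta> where "\<delta> \<in> S" "\<forall>i<\<delta>. limit_of (C i) \<delta>"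
    using assms(1) unfolding stationary_def by blast
  then have "\<delta> \<in> C (f \<delta>)" using regressive C(1) by (auto simp: club_in_UNIV_iff)
  then show False using C(2) \<open>\<delta> \<in> S\<close> by blast
qed

end

end

subsection \<open>Closed copies of ordinals\<close>

text \<open>The requirement on the map in \<open>fat\<close>, isolated with an arbitrary target
  \<open>X\<close> so that copies can be restricted and thinned out.\<close>

definition closed_copy :: "'k::wellorder \<Rightarrow> ('k \<Rightarrow> 'k) \<Rightarrow> 'k set \<Rightarrow> bool" where
  "closed_copy \<theta> \<pi> X \<longleftrightarrow> \<pi> ` {..\<theta>} \<subseteq> X \<and> strict_mono_on {..\<theta>} \<pi> \<and>
     (\<forall>\<delta>\<le>\<theta>. \<delta> \<in> accum UNIV \<longrightarrow> \<pi> \<delta> = ord_sup (\<pi> ` {..<\<delta>}))"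

lemma fat_iff:
  fixes F :: "'k::wellorder set"
  shows "fat F \<longleftrightarrow> (\<forall>D (\<theta>::'k). club_in D UNIV \<longrightarrow> infinite_regular {..<\<theta>} \<longrightarrow>
    (\<exists>\<pi>. closed_copy \<theta> \<pi> (F \<inter> D)))"
  by (simp add: fat_def closed_copy_def)

lemma closed_copy_less: "closed_copy \<theta> \<pi> X \<Longrightarrow> \<eta> < \<xi> \<Longrightarrow> \<xi> \<le> \<theta> \<Longrightarrow> \<pi> \<eta> < \<pi> \<xi>"
  by (auto simp: closed_copy_def strict_mono_on_def)

lemma closed_copy_mem: "closed_copy \<theta> \<pi> X \<Longrightarrow> \<xi> \<le> \<theta> \<Longrightarrow> \<pi> \<xi> \<in> X"
  by (auto simp: closed_copy_def)

lemma closed_copy_cofinal: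
  "closed_copy \<theta> \<pi> X \<Longrightarrow> \<xi> \<le> \<theta> \<Longrightarrow> limit_of UNIV \<xi> \<Longrightarrow> x < \<pi> \<xi> \<Longrightarrow> \<exists>\<eta><\<xi>. x < \<pi> \<eta>"
  using less_ord_supD[of x "\<pi> ` {..<\<xi>}"] by (auto simp: closed_copy_def accum_iff)

lemma closed_copy_mono:
  "closed_copy \<theta> \<pi> X \<Longrightarrow> \<theta>' \<le> \<theta> \<Longrightarrow> X \<subseteq> Y \<Longrightarrow> closed_copy \<theta>' \<pi> Y"
  unfolding closed_copy_def strict_mono_on_def
  by (meson atMost_iff atMost_subset_iff image_mono order_trans subset_trans)

lemma infinite_regular_limit:
  assumes "infinite_regular {..<\<theta>}"
  shows "limit_of UNIV \<theta>"
proof -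
  have "{..<\<theta>} \<noteq> {}" using assms by (auto simp: infinite_regular_def)
  then obtain x where "x < \<theta>" by auto
  then show ?thesis
    by (rule limit_ofI) (use infinite_regular_greater[OF assms] in auto)
qed

text \<open>For the least \<xi> with \<open>\<gamma> \<le> \<pi> \<xi>\<close>, the earlier values
  are cofinal in \<gamma>. So \<xi> is a limit, and continuity gives
  \<open>\<pi> \<xi> = \<gamma>\<close>.\<close>

lemma closed_copy_range_closed:
  assumes \<pi>: "closed_copy \<theta> \<pi> X" and \<gamma>: "limit_of (\<pi> ` {..<\<theta>}) \<gamma>" "\<gamma> < \<pi> \<theta>"
  shows "\<gamma> \<in> \<pi> ` {..<\<theta>}"
proof -
  define \<xi> where "\<xi> = (LEAST \<xi>. \<gamma> \<le> \<pi> \<xi>)"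
  have le: "\<gamma> \<le> \<pi> \<xi>" unfolding \<xi>_def by (rule LeastI[of _ \<theta>]) (use \<gamma> in auto)
  have "\<xi> \<le> \<theta>" unfolding \<xi>_def by (rule Least_le) (use \<gamma> in auto)
  have below: "\<pi> \<eta> < \<gamma>" if "\<eta> < \<xi>" for \<eta>
    using not_less_Least[of \<eta> "\<lambda>\<xi>. \<gamma> \<le> \<pi> \<xi>"] that by (auto simp: \<xi>_def)
  have hit: "\<exists>\<eta><\<xi>. x < \<pi> \<eta>" if x: "x < \<gamma>" for x
  proof -
    obtain \<eta> where \<eta>: "\<eta> < \<theta>" "x < \<pi> \<eta>" "\<pi> \<eta> < \<gamma>" using limit_of_less[OF \<gamma>(1) x] by auto
    then have "\<eta> < \<xi>"
      using closed_copy_less[OF \<pi>, of \<xi> \<eta>] le by (cases "\<eta> = \<xi>") (force simp: not_less)+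
    then show ?thesis using \<eta> by blast
  qed
  have "ord_zero < \<gamma>" using \<gamma> by (auto simp: limit_of_def)
  then obtain \<eta>0 where "\<eta>0 < \<xi>" using hit by blast
  then have "limit_of UNIV \<xi>"
  proof (rule limit_ofI)
    fix \<eta> assume "\<eta> < \<xi>"
    then obtain \<eta>' where "\<eta>' < \<xi>" "\<pi> \<eta> < \<pi> \<eta>'" using below hit by blast
    moreover have "\<eta> < \<eta>'"
    proof (rule ccontr)
      assume "\<not> \<eta> < \<eta>'"
      then have "\<pi> \<eta>' \<le> \<pi> \<eta>"
        using closed_copy_less[OF \<pi>, of \<eta>' \<eta>] \<open>\<eta> < \<xi>\<close> \<open>\<xi> \<le> \<theta>\<close>
        by (metis less_imp_le not_less_iff_gr_or_eq order.refl order.strict_trans2)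
      then show False using calculation by simp
    qed
    ultimately show "\<exists>\<eta>'\<in>UNIV. \<eta> < \<eta>' \<and> \<eta>' < \<xi>" by blast
  qed
  then have "\<pi> \<xi> \<le> \<gamma>"
    using closed_copy_cofinal[OF \<pi> \<open>\<xi> \<le> \<theta>\<close>] below by (meson less_asym not_le)
  then have "\<gamma> = \<pi> \<xi>" using le by simp
  moreover have "\<xi> < \<theta>" using \<open>\<gamma> = \<pi> \<xi>\<close> \<gamma>(2) \<open>\<xi> \<le> \<theta>\<close> by (auto simp: le_less)
  ultimately show ?thesis by blast
qed

text \<open>Each \<open>g \<eta>\<close> lies below some \<open>\<pi> (\<zeta> \<eta>)\<close>;
  regularity of \<theta> bounds the indices \<open>\<zeta> \<eta>\<close>, and \<pi> carries the
  bound back.\<close>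

lemma closed_copy_bounded:
  assumes reg: "infinite_regular {..<\<theta>}" and \<pi>: "closed_copy \<theta> \<pi> X"
    and \<xi>: "\<xi> < \<theta>" and g: "\<And>\<eta>. \<eta> < \<xi> \<Longrightarrow> g \<eta> < \<pi> \<theta>"
  shows "\<exists>b<\<pi> \<theta>. \<forall>\<eta><\<xi>. g \<eta> < b"
proof -
  have "\<forall>\<eta>. \<exists>\<zeta>. \<eta> < \<xi> \<longrightarrow> \<zeta> < \<theta> \<and> g \<eta> < \<pi> \<zeta>"
    using closed_copy_cofinal[OF \<pi> order.refl infinite_regular_limit[OF reg]] g by blast
  then obtain \<zeta> where \<zeta>: "\<And>\<eta>. \<eta> < \<xi> \<Longrightarrow> \<zeta> \<eta> < \<theta> \<and> g \<eta> < \<pi> (\<zeta> \<eta>)" by metis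
  then obtain b where b: "b < \<theta>" "\<forall>\<eta><\<xi>. \<zeta> \<eta> < b"
    using infinite_regular_bounded_image[OF reg lower_lessThan, of \<xi> \<zeta>] \<xi> by auto
  have "g \<eta> < \<pi> b" if "\<eta> < \<xi>" for \<eta>
    using \<zeta>[OF that] b that closed_copy_less[OF \<pi>, of "\<zeta> \<eta>" b] by force
  then show ?thesis using closed_copy_less[OF \<pi> b(1)] by auto
qed

text \<open>The same passage to indices below \<theta>, now for sequences and using that \<theta> is
  uncountable.\<close>

lemma closed_copy_top_uncountable_cofinality:
  assumes reg: "infinite_regular {..<\<theta>}" and \<pi>: "closed_copy \<theta> \<pi> X" and "uncountable {..<\<theta>}"
  shows "uncountable_cofinality {..<\<pi> \<theta>}"
  unfolding uncountable_cofinality_def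
proof (intro allI impI)
  fix f :: "nat \<Rightarrow> 'a" assume f: "range f \<subseteq> {..<\<pi> \<theta>}"
  have "\<forall>n. \<exists>\<zeta>. \<zeta> < \<theta> \<and> f n < \<pi> \<zeta>"
    using closed_copy_cofinal[OF \<pi> order.refl infinite_regular_limit[OF reg]] f by blast
  then obtain \<zeta> where \<zeta>: "\<And>n. \<zeta> n < \<theta> \<and> f n < \<pi> (\<zeta> n)" by metis
  then have "range \<zeta> \<subseteq> {..<\<theta>}" by auto
  then obtain b where b: "b < \<theta>" "\<forall>n. \<zeta> n < b"
    using infinite_regular_uncountable_cofinality[OF reg assms(3)]
    unfolding uncountable_cofinality_def by blast
  have "f n < \<pi> b" for n
    using \<zeta>[of n] b closed_copy_less[OF \<pi>, of "\<zeta> n" b] by force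
  then show "\<exists>b\<in>{..<\<pi> \<theta>}. \<forall>n. f n < b" using closed_copy_less[OF \<pi> b(1)] by auto
qed

text \<open>Taking each value above the corresponding values of \<open>\<pi>\<close> makes the new copy cofinal in \<open>\<pi> \<theta>\<close>
  although only strict inequalities are imposed, so that continuity is kept at limits.\<close>

lemma closed_copy_thin:
  assumes reg: "infinite_regular {..<\<theta>}" and \<pi>: "closed_copy \<theta> \<pi> X"
    and A: "A \<subseteq> {..<\<pi> \<theta>}" "\<And>x. x < \<pi> \<theta> \<Longrightarrow> \<exists>a\<in>A. x < a"
    and closed: "\<And>\<xi> s. \<xi> < \<theta> \<Longrightarrow> limit_of UNIV \<xi> \<Longrightarrow> limit_of A s \<Longrightarrow> s < \<pi> \<theta> \<Longrightarrow> s \<in> A"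
  shows "\<exists>\<sigma>. closed_copy \<theta> \<sigma> (insert (\<pi> \<theta>) A)"
proof -
  define step where "step s \<xi> = (LEAST a. a \<in> A \<and> (\<forall>\<eta><\<xi>. s \<eta> < a \<and> \<pi> \<eta> < a))" for s \<xi>
  define \<sigma> where "\<sigma> = wfrec {(x, y). x < y} step"
  have \<sigma>_step: "\<sigma> \<xi> = step \<sigma> \<xi>" for \<xi>
  proof -
    have "\<sigma> \<xi> = step (cut \<sigma> {(x, y). x < y} \<xi>) \<xi>" unfolding \<sigma>_def by (rule wfrec[OF wf])
    also have "\<dots> = step \<sigma> \<xi>" by (simp add: step_def cut_apply)
    finally show ?thesis .
  qed
  have lim: "limit_of UNIV \<theta>" by (rule infinite_regular_limit[OF reg])
  have main: "\<sigma> \<xi> \<in> A \<and> (\<forall>\<eta><\<xi>. \<sigma> \<eta> < \<sigma> \<xi> \<and> \<pi> \<eta> < \<sigma> \<xi>)" if "\<xi> < \<theta>" for \<xi>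
    using that
  proof (induction \<xi> rule: less_induct)
    case (less \<xi>)
    have "max (\<sigma> \<eta>) (\<pi> \<eta>) < \<pi> \<theta>" if \<eta>: "\<eta> < \<xi>" for \<eta>
    proof -
      have "\<eta> < \<theta>" using \<eta> less.prems by (rule order.strict_trans)
      then show ?thesis using less.IH[OF \<eta>] A(1) closed_copy_less[OF \<pi>, of \<eta> \<theta>] by auto
    qed
    then obtain b where b: "b < \<pi> \<theta>" "\<forall>\<eta><\<xi>. max (\<sigma> \<eta>) (\<pi> \<eta>) < b"
      using closed_copy_bounded[OF reg \<pi> less.prems, of "\<lambda>\<eta>. max (\<sigma> \<eta>) (\<pi> \<eta>)"] by blast
    then obtain a where "a \<in> A" "b < a" using A(2) by blast
    then have "a \<in> A \<and> (\<forall>\<eta><\<xi>. \<sigma> \<eta> < a \<and> \<pi> \<eta> < a)" using b by force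
    then have "step \<sigma> \<xi> \<in> A \<and> (\<forall>\<eta><\<xi>. \<sigma> \<eta> < step \<sigma> \<xi> \<and> \<pi> \<eta> < step \<sigma> \<xi>)"
      unfolding step_def by (rule LeastI)
    then show ?case using \<sigma>_step[of \<xi>] by simp
  qed
  have least: "\<sigma> \<xi> \<le> a" if "a \<in> A" "\<forall>\<eta><\<xi>. \<sigma> \<eta> < a \<and> \<pi> \<eta> < a" for \<xi> a
    unfolding \<sigma>_step[of \<xi>] step_def by (rule Least_le) (use that in auto)
  \<comment> \<open>The recursion is controlled only below \<theta>; the top is set separately
    because \<open>\<pi> \<theta>\<close> lies outside \<open>A\<close>.\<close>
  let ?\<sigma> = "\<sigma>(\<theta> := \<pi> \<theta>)"
  have "?\<sigma> ` {..\<theta>} \<subseteq> insert (\<pi> \<theta>) A" using main by (auto simp: le_less)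
  moreover have "strict_mono_on {..\<theta>} ?\<sigma>"
    using main A(1) by (force simp: strict_mono_on_def le_less)
  moreover have "?\<sigma> \<xi> = ord_sup (?\<sigma> ` {..<\<xi>})" if \<xi>: "\<xi> \<le> \<theta>" "limit_of UNIV \<xi>" for \<xi>
  proof (cases "\<xi> = \<theta>")
    case True
    have "\<exists>\<eta><\<theta>. x < \<sigma> \<eta>" if x: "x < \<pi> \<theta>" for x
    proof -
      obtain \<eta> where "\<eta> < \<theta>" "x < \<pi> \<eta>" using closed_copy_cofinal[OF \<pi> order.refl lim x] by blast
      moreover obtain \<eta>' where "\<eta>' < \<theta>" "\<eta> < \<eta>'" using limit_of_less[OF lim \<open>\<eta> < \<theta>\<close>] by auto
      ultimately show ?thesis using main[of \<eta>'] by force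
    qed
    then have "\<pi> \<theta> = ord_sup (\<sigma> ` {..<\<theta>})"
      using main A(1) by (intro ord_sup_eqI[symmetric]) force+
    moreover have "?\<sigma> ` {..<\<theta>} = \<sigma> ` {..<\<theta>}" by auto
    ultimately show ?thesis using True by simp
  next
    case False
    then have lt: "\<xi> < \<theta>" using \<xi> by simp
    \<comment> \<open>This supremum is a limit of \<open>A\<close>, hence in \<open>A\<close>, and
      strictly exceeds all earlier values of \<sigma> and \<pi>. Since \<open>step\<close> takes the
      least such element, \<open>\<sigma> \<xi> = s\<close>.\<close>
    define s where "s = ord_sup (\<sigma> ` {..<\<xi>})"
    have ge: "s \<le> b" if "\<forall>\<eta><\<xi>. \<sigma> \<eta> \<le> b" for b
      unfolding s_def ord_sup_def by (rule Least_le) (use that in auto)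
    have up: "\<sigma> \<eta> \<le> s" if "\<eta> < \<xi>" for \<eta>
      unfolding s_def ord_sup_def by (rule LeastI2[of _ "\<sigma> \<xi>"]) (use main[OF lt] that in \<open>auto simp: less_imp_le\<close>)
    have up': "\<sigma> \<eta> < s \<and> \<pi> \<eta> < s" if \<eta>: "\<eta> < \<xi>" for \<eta>
    proof -
      obtain \<eta>' where "\<eta>' < \<xi>" "\<eta> < \<eta>'" using limit_of_less[OF \<xi>(2) \<eta>] by auto
      then show ?thesis using main[of \<eta>'] up[of \<eta>'] lt by force
    qed
    have "s \<le> \<sigma> \<xi>" using main[OF lt] by (intro ge) (auto simp: less_imp_le)
    moreover have "s < \<pi> \<theta>" using calculation main[OF lt] A(1) by force
    moreover have "limit_of A s"
    proof -
      have "ord_zero < \<xi>" using \<xi> by (auto simp: limit_of_def)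
      then have "\<sigma> ord_zero < s" using up' by blast
      then show ?thesis
      proof (rule limit_ofI)
        fix x assume "x < s"
        then obtain \<eta> where "\<eta> < \<xi>" "x < \<sigma> \<eta>" using less_ord_supD[of x "\<sigma> ` {..<\<xi>}"] by (auto simp: s_def)
        then show "\<exists>c\<in>A. x < c \<and> c < s" using main[of \<eta>] up' lt by force
      qed
    qed
    ultimately have "\<sigma> \<xi> = s" using closed[OF lt \<xi>(2)] least[of s \<xi>] up' by force
    moreover have "?\<sigma> ` {..<\<xi>} = \<sigma> ` {..<\<xi>}" using lt by auto
    ultimately show ?thesis using False by (simp add: s_def)
  qed
  ultimately show ?thesis unfolding closed_copy_def accum_iff by blast
qed

subsection \<open>Colouring by the next element of the square sequence\<close>

text \<open>Coherence in the exact sense, without the exception allowed by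
  \<open>init_seg_mod\<close>. When \<open>\<C> \<alpha> = {c \<alpha>}\<close> at all limits, this
  is \<open>Gamma \<C>\<close>.\<close>

definition coherent_at :: "('k::wellorder \<Rightarrow> 'k set) \<Rightarrow> 'k set" where
  "coherent_at c = {\<delta>. limit_of UNIV \<delta> \<and> (\<forall>\<beta>\<in>accum (c \<delta>). c \<beta> = c \<delta> \<inter> {..<\<beta>})}"

text \<open>The colour \<open>h\<^sub>i \<delta>\<close> is
  \<open>next_above (c \<delta>) i\<close>. If no element of \<open>C\<close> exceeds
  \<open>i\<close>, the value is one unspecified constant, which does not depend on \<open>C\<close>
  or \<open>i\<close>.\<close>

definition next_above :: "'k::wellorder set \<Rightarrow> 'k \<Rightarrow> 'k" where
  "next_above C i = (LEAST x. x \<in> C \<and> i < x)"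

lemma next_above:
  assumes "x \<in> C" "i < x"
  shows "next_above C i \<in> C" "i < next_above C i" "next_above C i \<le> x"
  using LeastI[of "\<lambda>x. x \<in> C \<and> i < x" x] Least_le[of "\<lambda>x. x \<in> C \<and> i < x" x] assms
  by (auto simp: next_above_def)

lemma next_above_mono:
  assumes "x \<in> C" "j < x" "i \<le> j"
  shows "next_above C i \<le> next_above C j"
  using next_above[OF assms(1,2)] next_above(3)[of "next_above C j" C i] assms(3) by auto

text \<open>A cut above the next element keeps the minimum; in the second case both minima run over
  the empty set and agree by default.\<close>

lemma next_above_Int:
  assumes "next_above C i < \<beta> \<or> (\<forall>x\<in>C. x \<le> i)"
  shows "next_above (C \<inter> {..<\<beta>}) i = next_above C i"
proof (cases "\<exists>x\<in>C. i < x")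
  case True
  then obtain x where x: "x \<in> C" "i < x" by blast
  then have "next_above C i \<in> C \<inter> {..<\<beta>}" using next_above[OF x] assms by force
  from next_above[OF this next_above(2)[OF x]] show ?thesis
    using next_above(3)[of "next_above (C \<inter> {..<\<beta>}) i" C i] by auto
next
  case False
  then have "(\<lambda>x. x \<in> C \<inter> {..<\<beta>} \<and> i < x) = (\<lambda>x. x \<in> C \<and> i < x)" by auto
  then show ?thesis by (simp add: next_above_def)
qed

lemma next_above_coherent:
  assumes "\<delta> \<in> coherent_at c" "\<beta> \<in> accum (c \<delta>)"
    and "next_above (c \<delta>) i < \<beta> \<or> (\<forall>x\<in>c \<delta>. x \<le> i)"
  shows "next_above (c \<beta>) i = next_above (c \<delta>) i"
  using assms next_above_Int[OF assms(3)] by (auto simp: coherent_at_def)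

section \<open>Tops of closed copies in a fat set: the sets \<open>S\<^sub>\<theta>\<close>\<close>

definition tops :: "'k::wellorder \<Rightarrow> 'k set \<Rightarrow> 'k set" where
  "tops \<theta> F = {\<pi> \<theta> | \<pi>. closed_copy \<theta> \<pi> F}"

lemma tops_subset: "tops \<theta> F \<subseteq> F"
  by (auto simp: tops_def closed_copy_mem)

lemma fat_stationary_tops:
  fixes F :: "'k::wellorder set"
  assumes "fat F" "infinite_regular {..<\<theta>}"
  shows "stationary (tops \<theta> F)"
  unfolding stationary_def
proof (intro allI impI)
  fix D :: "'k set" assume "club_in D UNIV"
  then obtain \<pi> where \<pi>: "closed_copy \<theta> \<pi> (F \<inter> D)" using assms unfolding fat_iff by blast
  then have "\<pi> \<theta> \<in> D" using closed_copy_mem by blast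
  moreover have "\<pi> \<theta> \<in> tops \<theta> F"
    using closed_copy_mono[OF \<pi> order.refl, of F] unfolding tops_def by blast
  ultimately show "tops \<theta> F \<inter> D \<noteq> {}" by blast
qed

lemma limit_of_infinite:
  assumes "limit_of UNIV \<xi>"
  shows "infinite {..<\<xi>}"
proof
  assume fin: "finite {..<\<xi>}"
  have "{..<\<xi>} \<noteq> {}" using assms by (auto simp: limit_of_def)
  then have "Max {..<\<xi>} < \<xi>" using Max_in[OF fin] by blast
  then obtain c where "Max {..<\<xi>} < c" "c < \<xi>" using limit_of_less[OF assms] by blast
  then show False using Max_ge[OF fin, of c] by auto
qed

text \<open>Identifies the countable case as \<omega>: an infinite proper segment would already have
  the cardinality of \<open>A\<close>.\<close>

lemma infinite_regular_countable_segment: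
  assumes "infinite_regular A" "lower A" "countable A" "x \<in> A"
  shows "finite {..<x}"
proof (rule ccontr)
  assume "infinite {..<x}"
  then have "|UNIV :: nat set| \<le>o |{..<x}|" by (simp add: infinite_iff_card_of_nat)
  moreover have "|A| \<le>o |UNIV :: nat set|"
    using assms(3) unfolding countable_def by (metis card_of_ordLeq subset_UNIV)
  ultimately show False
    using infinite_regular_segment[OF assms(1,2,4)] not_ordLess_ordLeq ordLeq_transitive by blast
qed

text \<open>A copy of \<theta> with top \<delta> of colour \<tau> is thinned to points of the same
  colour in \<open>D\<close>. For uncountable \<theta>, the range of the copy, \<open>D\<close> and
  the accumulation points of \<open>c \<delta>\<close> have a common cofinal closed part. For
  countable \<theta>, cofinally many points of the fibre suffice.\<close>

lemma closed_copy_in_fibre: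
  fixes F :: "'k::wellorder set"
  assumes reg: "infinite_regular (UNIV :: 'k set)" and unc: "uncountable (UNIV :: 'k set)"
    and c: "\<And>\<delta>. limit_of UNIV \<delta> \<Longrightarrow> club_in (c \<delta>) {..<\<delta>}"
    and \<theta>: "infinite_regular {..<\<theta>}" and coh: "tops \<theta> F \<subseteq> coherent_at c"
    and stat: "stationary {\<delta>\<in>tops \<theta> F. next_above (c \<delta>) i = \<tau>}" (is "stationary ?S")
    and D: "club_in D UNIV"
  shows "\<exists>\<pi>. closed_copy \<theta> \<pi> ({\<delta>\<in>F. next_above (c \<delta>) i = \<tau>} \<inter> D)"
proof (cases "countable {..<\<theta>}")
  case True
  let ?X = "{\<delta>\<in>F. next_above (c \<delta>) i = \<tau>} \<inter> D"
  have SX: "?S \<inter> D \<subseteq> ?X" using tops_subset[of \<theta> F] by blast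
  have "\<exists>\<delta>\<in>?X. x < \<delta>" for x
    using stationary_cofinal[OF reg unc stationary_Int_club[OF reg unc stat D], of x] SX by blast
  \<comment> \<open>Stationarity is used twice: it makes \<open>?X\<close> unbounded, and then it
    yields a top \<delta> that is a limit of \<open>?X\<close>.\<close>
  then have "club_in {\<gamma>. limit_of ?X \<gamma>} UNIV" by (rule club_limits[OF reg unc])
  then obtain \<delta> where \<delta>: "\<delta> \<in> ?S \<inter> D" "limit_of ?X \<delta>"
    using stationary_Int_club[OF reg unc stat D] unfolding stationary_def by blast
  then obtain \<pi> where \<pi>: "closed_copy \<theta> \<pi> F" "\<delta> = \<pi> \<theta>" unfolding tops_def by blast
  have "\<exists>\<sigma>. closed_copy \<theta> \<sigma> (insert (\<pi> \<theta>) (?X \<inter> {..<\<delta>}))"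
  proof (rule closed_copy_thin[OF \<theta> \<pi>(1)])
    show "\<exists>a\<in>?X \<inter> {..<\<delta>}. x < a" if "x < \<pi> \<theta>" for x
      using limit_of_less[OF \<delta>(2), of x] that \<pi>(2) by auto
    \<comment> \<open>Vacuous: segments below the countable \<theta> are finite, so no limit \<xi>
      lies below \<theta>.\<close>
    show "s \<in> ?X \<inter> {..<\<delta>}" if "\<xi> < \<theta>" "limit_of UNIV \<xi>" for \<xi> s
      using infinite_regular_countable_segment[OF \<theta> lower_lessThan True, of \<xi>] limit_of_infinite that
      by blast
  qed (use \<pi> in auto)
  then show ?thesis using closed_copy_mono[OF _ order.refl] SX \<delta>(1) \<pi>(2)
    by (metis (no_types, lifting) inf_le1 insert_subset subsetD)
next
  case False
  \<comment> \<open>The bound \<open>\<tau> < \<delta>\<close> leaves room for points between \<tau>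
    and \<delta>, which inherit the colour \<tau> from \<delta>.\<close>
  have "stationary {\<delta> \<in> ?S. \<tau> < \<delta>}" by (rule stationary_Collect_greater[OF reg unc stat])
  moreover have "club_in {\<gamma>. limit_of D \<gamma>} UNIV"
    using D by (intro club_limits[OF reg unc]) (auto simp: club_in_UNIV_iff[OF reg unc])
  ultimately obtain \<delta> where \<delta>: "\<delta> \<in> ?S" "\<tau> < \<delta>" "limit_of D \<delta>"
    unfolding stationary_def by blast
  then obtain \<pi> where \<pi>: "closed_copy \<theta> \<pi> F" "\<delta> = \<pi> \<theta>" unfolding tops_def by blast
  have co: "\<delta> \<in> coherent_at c" using \<delta>(1) coh by blast
  then have lim: "limit_of UNIV \<delta>" by (simp add: coherent_at_def)
  have c\<delta>: "c \<delta> \<subseteq> {..<\<delta>}" "\<And>x. x < \<delta> \<Longrightarrow> \<exists>y\<in>c \<delta>. x < y"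
      "\<And>\<alpha>. \<alpha> < \<delta> \<Longrightarrow> limit_of (c \<delta>) \<alpha> \<Longrightarrow> \<alpha> \<in> c \<delta>"
    using c[OF lim] by (auto simp: club_in_iff)
  have Dcl: "\<And>\<alpha>. limit_of D \<alpha> \<Longrightarrow> \<alpha> \<in> D" using D by (simp add: club_in_iff)
  let ?P = "\<pi> ` {..<\<theta>}"
  have P\<delta>: "\<pi> \<eta> < \<delta>" if "\<eta> < \<theta>" for \<eta> using closed_copy_less[OF \<pi>(1) that] \<pi>(2) by simp
  have Pcof: "\<exists>y\<in>?P. x < y" if "x < \<delta>" for x
    using closed_copy_cofinal[OF \<pi>(1) order.refl infinite_regular_limit[OF \<theta>]] that \<pi>(2) by blast
  \<comment> \<open>The range puts these points into \<open>F\<close>; being accumulation points of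
    \<open>c \<delta>\<close> above \<tau>, they have colour \<tau> by coherence.\<close>
  let ?A = "{\<beta>\<in>?P \<inter> D \<inter> accum (c \<delta>). \<tau> < \<beta>}"
  have mem: "\<gamma> \<in> ?A" if "limit_of ?P \<gamma>" "limit_of D \<gamma>" "limit_of (c \<delta>) \<gamma>" "\<tau> < \<gamma>" "\<gamma> < \<delta>" for \<gamma>
    using that closed_copy_range_closed[OF \<pi>(1), of \<gamma>] \<pi>(2) Dcl c\<delta>(3) by (auto simp: accum_iff)
  have "\<exists>\<sigma>. closed_copy \<theta> \<sigma> (insert (\<pi> \<theta>) ?A)"
  proof (rule closed_copy_thin[OF \<theta> \<pi>(1)])
    show "?A \<subseteq> {..<\<pi> \<theta>}" using P\<delta> \<pi>(2) by auto
    show "\<exists>a\<in>?A. x < a" if "x < \<pi> \<theta>" for x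
    proof -
      \<comment> \<open>A closure point of \<open>?R\<close> is a limit of the range, of
        \<open>D\<close> and of \<open>c \<delta>\<close> at once, hence lies in
        \<open>?A\<close>.\<close>
      let ?between = "\<lambda>X x z. \<exists>y\<in>X. x < y \<and> y < z"
      let ?R = "\<lambda>x z. x < z \<and> ?between ?P x z \<and> ?between D x z \<and> ?between (c \<delta>) x z"
      have "\<exists>z\<in>{..<\<delta>}. ?R x z" if x: "x \<in> {..<\<delta>}" for x
      proof -
        obtain p where p: "p \<in> ?P" "x < p" using Pcof[of x] x by blast
        obtain d where d: "d \<in> D" "x < d" "d < \<delta>" using limit_of_less[OF \<delta>(3), of x] x by blast
        obtain y where y: "y \<in> c \<delta>" "x < y" using c\<delta>(2)[of x] x by blast
        have "max p (max d y) < \<delta>" using p d y P\<delta> c\<delta>(1) by auto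
        then obtain z where "max p (max d y) < z" "z < \<delta>" using limit_of_less[OF lim, of "max p (max d y)"] by blast
        then have "?R x z" using p d y by auto
        then show ?thesis using \<open>z < \<delta>\<close> by blast
      qed
      moreover have "?R x z" if "x \<le> y" "?R y z" for x y z
        using that by (meson le_less_trans)
      moreover have "max x \<tau> \<in> {..<\<delta>}" using that \<pi>(2) \<delta>(2) by simp
      moreover have "uncountable_cofinality {..<\<delta>}"
        using closed_copy_top_uncountable_cofinality[OF \<theta> \<pi>(1) False] \<pi>(2) by simp
      ultimately obtain \<gamma> where \<gamma>: "\<gamma> < \<delta>" "max x \<tau> < \<gamma>" "\<forall>x<\<gamma>. \<exists>z<\<gamma>. ?R x z"
        using closure_point[of "{..<\<delta>}" ?R "max x \<tau>"] by auto
      have limitI: "limit_of X \<gamma>" if "\<forall>x<\<gamma>. \<exists>z<\<gamma>. ?between X x z" for X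
        by (rule limit_ofI[OF \<gamma>(2)]) (use that order.strict_trans in blast)
      have "limit_of ?P \<gamma>" by (rule limitI) (use \<gamma>(3) in metis)
      moreover have "limit_of D \<gamma>" by (rule limitI) (use \<gamma>(3) in metis)
      moreover have "limit_of (c \<delta>) \<gamma>" by (rule limitI) (use \<gamma>(3) in metis)
      ultimately have "\<gamma> \<in> ?A" using \<gamma>(1,2) by (intro mem) auto
      then show ?thesis using \<gamma>(2) by auto
    qed
    show "s \<in> ?A" if "limit_of ?A s" "s < \<pi> \<theta>" for s
    proof (rule mem)
      show "limit_of ?P s" "limit_of D s" "limit_of (c \<delta>) s"
        by (rule limit_of_mono[OF that(1)]; auto simp: accum_iff)+
      have "\<exists>a\<in>?A. ord_zero < a \<and> a < s" using that(1) unfolding limit_of_def by blast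
      then show "\<tau> < s" by auto
    qed (use that \<pi>(2) in simp)
  qed
  moreover have "next_above (c \<beta>) i = \<tau>" if "\<beta> \<in> ?A" for \<beta>
    using next_above_coherent[OF co, of \<beta> i] that \<delta>(1) by simp
  then have "insert (\<pi> \<theta>) ?A \<subseteq> {\<delta>\<in>F. next_above (c \<delta>) i = \<tau>} \<inter> D"
    using closed_copy_mem[OF \<pi>(1)] \<delta> Dcl \<pi>(2) by (auto simp: less_imp_le)
  ultimately show ?thesis using closed_copy_mono[OF _ order.refl] by blast
qed

section \<open>Stationary colours from the absence of a thread\<close>

context
  fixes c :: "'k::wellorder \<Rightarrow> 'k set"
  assumes reg: "infinite_regular (UNIV :: 'k set)" and unc: "uncountable (UNIV :: 'k set)"
    and club: "\<And>\<delta>. limit_of UNIV \<delta> \<Longrightarrow> club_in (c \<delta>) {..<\<delta>}"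
    and no_thread: "\<And>A. (\<And>x. \<exists>a\<in>A. x < a) \<Longrightarrow> \<exists>\<alpha>. limit_of A \<alpha> \<and> c \<alpha> \<noteq> A \<inter> {..<\<alpha>}"
begin

lemma unbounded_below_limit: "limit_of UNIV \<delta> \<Longrightarrow> x < \<delta> \<Longrightarrow> \<exists>y\<in>c \<delta>. x < y"
  using club by (auto simp: club_in_iff)

lemma closed_below_limit: "limit_of UNIV \<delta> \<Longrightarrow> \<alpha> < \<delta> \<Longrightarrow> limit_of (c \<delta>) \<alpha> \<Longrightarrow> \<alpha> \<in> c \<delta>"
  using club by (auto simp: club_in_iff)

lemma subset_below_limit: "limit_of UNIV \<delta> \<Longrightarrow> c \<delta> \<subseteq> {..<\<delta>}"
  using club by (auto simp: club_in_iff)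

lemma next_above_limit:
  assumes "limit_of UNIV \<delta>" "i < \<delta>"
  shows "next_above (c \<delta>) i \<in> c \<delta>" "i < next_above (c \<delta>) i" "next_above (c \<delta>) i < \<delta>"
proof -
  obtain y where y: "y \<in> c \<delta>" "i < y" using unbounded_below_limit[OF assms] by blast
  show "next_above (c \<delta>) i \<in> c \<delta>" "i < next_above (c \<delta>) i" using next_above[OF y] by blast+
  then show "next_above (c \<delta>) i < \<delta>" using subset_below_limit[OF assms(1)] by blast
qed

text \<open>Otherwise, for each \<open>m\<close> some \<delta> above \<open>m\<close> satisfies
  \<open>next_above (c \<delta>) i \<le> g i\<close> for all \<open>i < m\<close>. Limits closed
  under \<open>g\<close> then become accumulation points of such \<open>c \<delta>\<close>, so the
  sets \<open>c \<epsilon>\<close> at these limits extend one another and their union contradicts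
  \<open>no_thread\<close>.\<close>

lemma exists_large_gaps:
  assumes stat: "\<And>\<theta>. \<theta> \<in> \<Theta> \<Longrightarrow> stationary (S \<theta>)" and coh: "\<And>\<theta>. \<theta> \<in> \<Theta> \<Longrightarrow> S \<theta> \<subseteq> coherent_at c"
  shows "\<exists>m. \<forall>\<theta>\<in>\<Theta>. \<exists>i<m. stationary {\<delta>\<in>S \<theta>. g i < next_above (c \<delta>) i}"
proof (rule ccontr)
  assume "\<not> ?thesis"
  then have small: "\<exists>\<theta>\<in>\<Theta>. \<forall>i<m. \<not> stationary {\<delta>\<in>S \<theta>. g i < next_above (c \<delta>) i}" for m
    by blast
  define E where "E = {\<epsilon>. limit_of UNIV \<epsilon> \<and> (\<forall>i<\<epsilon>. g i < \<epsilon>)}"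
  have E_unbounded: "\<exists>\<epsilon>\<in>E. x < \<epsilon>" for x
  proof -
    let ?R = "\<lambda>x z. x < z \<and> (\<forall>i\<le>x. g i < z)"
    have "\<exists>z. ?R x z" for x
    proof -
      obtain b where b: "\<forall>i\<le>x. max i (g i) < b"
        using bounded_on_closed_segment[OF reg, of x "\<lambda>i. max i (g i)"] by blast
      then have "?R x b" by auto
      then show ?thesis ..
    qed
    moreover have "?R x z" if "x \<le> y" "?R y z" for x y z using that by (meson le_less_trans order_trans)
    ultimately obtain \<gamma> where \<gamma>: "x < \<gamma>" "\<forall>x<\<gamma>. \<exists>z<\<gamma>. ?R x z"
      using closure_point_UNIV[OF reg unc, of ?R x] by blast
    have "limit_of UNIV \<gamma>" by (rule limit_ofI[OF \<gamma>(1)]) (use \<gamma>(2) in blast)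
    moreover have "g i < \<gamma>" if "i < \<gamma>" for i using \<gamma>(2) that by (meson order.refl order.strict_trans)
    ultimately show ?thesis using \<gamma>(1) unfolding E_def by blast
  qed
  have common: "\<exists>\<delta>\<in>coherent_at c. \<epsilon> \<in> accum (c \<delta>) \<and> \<epsilon>' \<in> accum (c \<delta>)"
    if E: "\<epsilon> \<in> E" "\<epsilon>' \<in> E" "\<epsilon> \<le> \<epsilon>'" for \<epsilon> \<epsilon>'
  proof -
    obtain \<theta> where \<theta>: "\<theta> \<in> \<Theta>" "\<And>i. i < \<epsilon>' \<Longrightarrow> \<not> stationary {\<delta>\<in>S \<theta>. g i < next_above (c \<delta>) i}"
      using small[of \<epsilon>'] by blast
    let ?S = "{\<delta>\<in>S \<theta>. \<epsilon>' < \<delta>}"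
    have statS: "stationary ?S" by (rule stationary_Collect_greater[OF reg unc stat[OF \<theta>(1)]])
    \<comment> \<open>If every \<delta> in \<open>?S\<close> had a bad index below
      \<open>\<epsilon>'\<close>, choosing it would be regressive, and Fodor's lemma would make one
      index bad on a stationary set.\<close>
    have "\<exists>\<delta>\<in>?S. \<forall>i<\<epsilon>'. next_above (c \<delta>) i \<le> g i"
    proof (rule ccontr)
      assume "\<not> ?thesis"
      then have "\<forall>\<delta>. \<exists>i. \<delta> \<in> ?S \<longrightarrow> i < \<epsilon>' \<and> g i < next_above (c \<delta>) i" by (meson not_le)
      then obtain f where f: "\<And>\<delta>. \<delta> \<in> ?S \<Longrightarrow> f \<delta> < \<epsilon>' \<and> g (f \<delta>) < next_above (c \<delta>) (f \<delta>)" by metis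
      have "\<exists>i. stationary {\<delta>\<in>?S. f \<delta> = i}"
        by (rule fodor[OF reg unc statS]) (use f order.strict_trans in blast)
      then obtain i where i: "stationary {\<delta>\<in>?S. f \<delta> = i}" by blast
      then have "i < \<epsilon>'" using stationary_cofinal[OF reg unc i] f by blast
      moreover have "stationary {\<delta>\<in>S \<theta>. g i < next_above (c \<delta>) i}"
        by (rule stationary_mono[OF i]) (use f in blast)
      ultimately show False using \<theta>(2) by blast
    qed
    then obtain \<delta> where \<delta>: "\<delta> \<in> S \<theta>" "\<epsilon>' < \<delta>" "\<And>i. i < \<epsilon>' \<Longrightarrow> next_above (c \<delta>) i \<le> g i" by blast
    have co: "\<delta> \<in> coherent_at c" using \<delta>(1) coh \<theta>(1) by blast
    then have lim: "limit_of UNIV \<delta>" by (simp add: coherent_at_def)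
    \<comment> \<open>For \<open>i < \<zeta>\<close> the next element of \<open>c \<delta>\<close>
      above \<open>i\<close> is at most \<open>g i\<close>, hence below \<zeta>.\<close>
    have "\<zeta> \<in> accum (c \<delta>)" if \<zeta>: "\<zeta> \<in> E" "\<zeta> \<le> \<epsilon>'" for \<zeta>
    proof -
      have "limit_of (c \<delta>) \<zeta>"
        unfolding limit_of_def
      proof (intro conjI allI impI)
        show "ord_zero < \<zeta>" using \<zeta> by (simp add: E_def limit_of_def)
        fix i assume i: "i < \<zeta>"
        then have "i < \<epsilon>'" "i < \<delta>" "g i < \<zeta>" using \<zeta> \<delta>(2) by (auto simp: E_def)
        then show "\<exists>y\<in>c \<delta>. i < y \<and> y < \<zeta>"
          using next_above_limit[OF lim \<open>i < \<delta>\<close>] \<delta>(3)[OF \<open>i < \<epsilon>'\<close>] le_less_trans by blast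
      qed
      then show ?thesis using closed_below_limit[OF lim, of \<zeta>] \<zeta>(2) \<delta>(2) by (auto simp: accum_iff)
    qed
    then show ?thesis using co E by blast
  qed
  have initial: "c \<epsilon> = c \<epsilon>' \<inter> {..<\<epsilon>}" if E: "\<epsilon> \<in> E" "\<epsilon>' \<in> E" "\<epsilon> \<le> \<epsilon>'" for \<epsilon> \<epsilon>'
  proof -
    obtain \<delta> where "\<delta> \<in> coherent_at c" "\<epsilon> \<in> accum (c \<delta>)" "\<epsilon>' \<in> accum (c \<delta>)"
      using common[OF E] by blast
    then have "c \<epsilon> = c \<delta> \<inter> {..<\<epsilon>}" "c \<epsilon>' = c \<delta> \<inter> {..<\<epsilon>'}" by (auto simp: coherent_at_def)
    then show ?thesis using E(3) by auto
  qed
  let ?A = "\<Union>\<epsilon>\<in>E. c \<epsilon>"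
  have trace: "?A \<inter> {..<\<epsilon>} = c \<epsilon>" if \<epsilon>: "\<epsilon> \<in> E" for \<epsilon>
  proof -
    have "x \<in> c \<epsilon>" if x: "x \<in> c \<epsilon>'" "\<epsilon>' \<in> E" "x < \<epsilon>" for x \<epsilon>'
    proof (cases "\<epsilon> \<le> \<epsilon>'")
      case True
      show ?thesis unfolding initial[OF \<epsilon> x(2) True] using x(1,3) by blast
    next
      case False
      then have "\<epsilon>' \<le> \<epsilon>" by simp
      from initial[OF x(2) \<epsilon> this] show ?thesis using x(1) by blast
    qed
    moreover have "c \<epsilon> \<subseteq> {..<\<epsilon>}" using \<epsilon> subset_below_limit by (simp add: E_def)
    ultimately show ?thesis using \<epsilon> by blast
  qed
  have "\<exists>a\<in>?A. x < a" for x
  proof -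
    obtain \<epsilon> where "\<epsilon> \<in> E" "x < \<epsilon>" using E_unbounded by blast
    then show ?thesis using unbounded_below_limit[of \<epsilon> x] by (auto simp: E_def)
  qed
  then obtain \<alpha> where \<alpha>: "limit_of ?A \<alpha>" "c \<alpha> \<noteq> ?A \<inter> {..<\<alpha>}" using no_thread[of ?A] by blast
  \<comment> \<open>The point \<alpha> need not be in \<open>E\<close>. It is an accumulation point
    of \<open>c \<delta>\<close> for a coherent \<delta> belonging to a larger \<epsilon>, and
    coherence at \<delta> determines \<open>c \<alpha>\<close>.\<close>
  obtain \<epsilon> where \<epsilon>: "\<epsilon> \<in> E" "\<alpha> < \<epsilon>" using E_unbounded by blast
  obtain \<delta> where \<delta>: "\<delta> \<in> coherent_at c" "\<epsilon> \<in> accum (c \<delta>)" using common[OF \<epsilon>(1) \<epsilon>(1)] by blast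
  then have c\<epsilon>: "c \<epsilon> = c \<delta> \<inter> {..<\<epsilon>}" and lim: "limit_of UNIV \<delta>" by (auto simp: coherent_at_def)
  have eq: "?A \<inter> {..<\<alpha>} = c \<delta> \<inter> {..<\<alpha>}"
  proof -
    have "?A \<inter> {..<\<alpha>} = (?A \<inter> {..<\<epsilon>}) \<inter> {..<\<alpha>}" using \<epsilon>(2) by auto
    also have "\<dots> = c \<delta> \<inter> {..<\<alpha>}" unfolding trace[OF \<epsilon>(1)] c\<epsilon> using \<epsilon>(2) by auto
    finally show ?thesis .
  qed
  then have "limit_of (c \<delta>) \<alpha>" using \<alpha>(1) unfolding limit_of_iff by simp
  moreover have "\<alpha> < \<delta>" using \<epsilon>(2) \<delta>(2) subset_below_limit[OF lim] by (auto simp: accum_iff)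
  ultimately have "\<alpha> \<in> accum (c \<delta>)" using closed_below_limit[OF lim] by (simp add: accum_iff)
  then have "c \<alpha> = c \<delta> \<inter> {..<\<alpha>}" using \<delta>(1) by (simp add: coherent_at_def)
  then show False using eq \<alpha>(2) by simp
qed

text \<open>If each \<open>i\<close> failed at some \<open>t i\<close> with bound
  \<open>b i\<close>, Fodor's lemma would bound \<open>next_above (c \<delta>) i\<close> by
  \<open>b i\<close> off a nonstationary part of \<open>S \<theta>\<close> whenever
  \<open>t i \<le> \<theta>\<close>. The two cases on \<Theta> assemble these bounds into one
  \<open>g\<close> violating \<open>exists_large_gaps\<close>.\<close>

lemma exists_separating_index:
  fixes \<Theta> :: "'k set"
  assumes ne: "\<Theta> \<noteq> {}" and stat: "\<And>\<theta>. \<theta> \<in> \<Theta> \<Longrightarrow> stationary (S \<theta>)"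
    and coh: "\<And>\<theta>. \<theta> \<in> \<Theta> \<Longrightarrow> S \<theta> \<subseteq> coherent_at c"
  shows "\<exists>i. \<forall>\<theta>\<in>\<Theta>. \<forall>b. \<exists>\<tau>>b. \<exists>\<theta>'\<in>\<Theta>. \<theta> \<le> \<theta>' \<and> stationary {\<delta>\<in>S \<theta>'. next_above (c \<delta>) i = \<tau>}"
proof (rule ccontr)
  assume contra: "\<not> ?thesis"
  define hit where "hit i \<theta> \<tau> \<longleftrightarrow>
    (\<exists>\<theta>'\<in>\<Theta>. \<theta> \<le> \<theta>' \<and> stationary {\<delta>\<in>S \<theta>'. next_above (c \<delta>) i = \<tau>})" for i \<theta> \<tau>
  have "\<forall>i. \<exists>\<theta> b. \<theta> \<in> \<Theta> \<and> (\<forall>\<tau>>b. \<not> hit i \<theta> \<tau>)"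
    using contra unfolding hit_def[symmetric] by blast
  then obtain t b where t: "\<And>i. t i \<in> \<Theta>" and b: "\<And>i \<tau>. b i < \<tau> \<Longrightarrow> \<not> hit i (t i) \<tau>" by metis
  have small: "\<not> stationary {\<delta>\<in>S \<theta>. b j < next_above (c \<delta>) i}"
    if \<theta>: "\<theta> \<in> \<Theta>" "t j \<le> \<theta>" "i \<le> j" for \<theta> i j
  proof
    \<comment> \<open>The condition \<open>j < \<delta>\<close> makes
      \<open>next_above (c \<delta>) j\<close> regressive. Its value on a stationary set exceeds
      \<open>b j\<close>, because the next element above \<open>j\<close> is at least the one above
      \<open>i\<close>.\<close>
    let ?S = "{\<delta>\<in>{\<delta>\<in>S \<theta>. b j < next_above (c \<delta>) i}. j < \<delta>}"
    assume "stationary {\<delta>\<in>S \<theta>. b j < next_above (c \<delta>) i}"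
    then have S: "stationary ?S" by (rule stationary_Collect_greater[OF reg unc])
    have lim: "limit_of UNIV \<delta>" if "\<delta> \<in> ?S" for \<delta>
      using that coh[OF \<theta>(1)] by (auto simp: coherent_at_def)
    have "\<exists>\<tau>. stationary {\<delta>\<in>?S. next_above (c \<delta>) j = \<tau>}"
      by (rule fodor[OF reg unc S]) (use lim next_above_limit(3) in blast)
    then obtain \<tau> where \<tau>: "stationary {\<delta>\<in>?S. next_above (c \<delta>) j = \<tau>}" by blast
    then obtain \<delta> where \<delta>: "\<delta> \<in> ?S" "next_above (c \<delta>) j = \<tau>"
      using stationary_cofinal[OF reg unc \<tau>] by blast
    then have j: "j < \<delta>" and i: "b j < next_above (c \<delta>) i" by auto
    have "next_above (c \<delta>) i \<le> next_above (c \<delta>) j"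
      by (rule next_above_mono[OF next_above_limit(1,2)[OF lim[OF \<delta>(1)] j] \<theta>(3)])
    then have "b j < \<tau>" using i \<delta>(2) by simp
    moreover have "stationary {\<delta>\<in>S \<theta>. next_above (c \<delta>) j = \<tau>}"
      by (rule stationary_mono[OF \<tau>]) blast
    ultimately show False using b \<theta>(1,2) unfolding hit_def by blast
  qed
  \<comment> \<open>If \<open>\<Theta>\<close> is bounded, a single \<open>\<theta>\<close> serves unboundedly many indices, and \<open>small\<close> passes the bound
    from \<open>j\<close> down to \<open>i \<le> j\<close>.\<close>
  have "\<exists>g. \<forall>m. \<exists>\<theta>\<in>\<Theta>. \<forall>i<m. \<not> stationary {\<delta>\<in>S \<theta>. g i < next_above (c \<delta>) i}"
  proof (cases "\<forall>x. \<exists>\<theta>\<in>\<Theta>. x < \<theta>")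
    case True
    have "\<exists>\<theta>\<in>\<Theta>. \<forall>i<m. \<not> stationary {\<delta>\<in>S \<theta>. b i < next_above (c \<delta>) i}" for m
    proof -
      \<comment> \<open>Fewer than \<kappa> thresholds are bounded, so one \<theta> exceeds them all
        and \<open>b\<close> itself serves as \<open>g\<close>.\<close>
      obtain x where x: "\<forall>i<m. t i < x" using bounded_on_segment[OF reg, of m t] by blast
      obtain \<theta> where "\<theta> \<in> \<Theta>" "x < \<theta>" using True by blast
      have "\<not> stationary {\<delta>\<in>S \<theta>. b i < next_above (c \<delta>) i}" if "i < m" for i
      proof (rule small[OF \<open>\<theta> \<in> \<Theta>\<close> _ order.refl])
        show "t i \<le> \<theta>" using x that \<open>x < \<theta>\<close> by (meson less_imp_le order.strict_trans)
      qed
      then show ?thesis using \<open>\<theta> \<in> \<Theta>\<close> by blast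
    qed
    then show ?thesis by blast
  next
    case False
    then obtain x where x: "\<And>\<theta>. \<theta> \<in> \<Theta> \<Longrightarrow> \<theta> \<le> x" by (meson not_le)
    have "\<exists>\<theta>\<in>\<Theta>. \<forall>y. \<exists>i\<ge>y. t i \<le> \<theta>"
    proof (rule ccontr)
      assume "\<not> ?thesis"
      then have "\<forall>\<theta>. \<exists>y. \<theta> \<in> \<Theta> \<longrightarrow> (\<forall>i\<ge>y. \<theta> < t i)" by (meson not_le)
      then obtain y where y: "\<And>\<theta> i. \<theta> \<in> \<Theta> \<Longrightarrow> y \<theta> \<le> i \<Longrightarrow> \<theta> < t i" by metis
      \<comment> \<open>Since \<open>t B\<close> is in \<Theta> and at most \<open>x\<close>, it has
        \<open>y (t B) < B\<close>; the property of \<open>y\<close> at \<open>t B\<close> and index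
        \<open>B\<close> is then absurd.\<close>
      obtain B where "\<forall>\<theta>\<le>x. y \<theta> < B" using bounded_on_closed_segment[OF reg, of x y] by blast
      then have "t B < t B" using y[OF t, of B B] x[OF t, of B] by (auto simp: less_imp_le)
      then show False by simp
    qed
    then obtain \<theta> n where n: "\<theta> \<in> \<Theta>" "\<And>i. i \<le> n i" "\<And>i. t (n i) \<le> \<theta>" by metis
    then have "\<not> stationary {\<delta>\<in>S \<theta>. b (n i) < next_above (c \<delta>) i}" for i
      by (intro small)
    then have "\<forall>m. \<exists>\<theta>\<in>\<Theta>. \<forall>i<m. \<not> stationary {\<delta>\<in>S \<theta>. b (n i) < next_above (c \<delta>) i}"
      using n(1) by blast
    then show ?thesis by (rule exI[of _ "\<lambda>i. b (n i)"])
  qed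
  then obtain g where g: "\<And>m. \<exists>\<theta>\<in>\<Theta>. \<forall>i<m. \<not> stationary {\<delta>\<in>S \<theta>. g i < next_above (c \<delta>) i}" by blast
  have "\<exists>m. \<forall>\<theta>\<in>\<Theta>. \<exists>i<m. stationary {\<delta>\<in>S \<theta>. g i < next_above (c \<delta>) i}"
    by (rule exists_large_gaps) (fact stat coh)+
  then show False using g by blast
qed

end

subsection \<open>The partition\<close>

text \<open>A recursion of length \<kappa> runs through all pairs \<open>(\<theta>, j)\<close> and
  picks for each with \<theta> in \<Theta> an element of \<open>U \<theta>\<close> above all earlier
  picks. Distinct pairs get distinct colours even if the sets \<open>U \<theta>\<close> overlap, so
  \<open>p\<close> can return the \<open>j\<close> of the pair owning a colour.\<close>

lemma colouring_onto_on_unbounded: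
  fixes U :: "'k::wellorder \<Rightarrow> 'k set"
  assumes reg: "infinite_regular (UNIV :: 'k set)"
    and U: "\<And>\<theta> b. \<theta> \<in> \<Theta> \<Longrightarrow> \<exists>\<tau>\<in>U \<theta>. b < \<tau>"
  shows "\<exists>p :: 'k \<Rightarrow> 'k. \<forall>\<theta>\<in>\<Theta>. \<forall>j. \<exists>\<tau>\<in>U \<theta>. p \<tau> = j"
proof -
  have "infinite (UNIV :: 'k set)" using reg by (simp add: infinite_regular_def)
  then have "|(UNIV :: 'k set) \<times> (UNIV :: 'k set)| =o |UNIV :: 'k set|" by (rule card_of_Times_same_infinite)
  then obtain e :: "'k \<Rightarrow> 'k \<times> 'k" where e: "bij_betw e UNIV (UNIV \<times> UNIV)"
    using card_of_ordIso ordIso_symmetric by blast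
  \<comment> \<open>Pairs with first entry outside \<Theta> take any value above the earlier ones,
    which keeps the recursion strictly increasing.\<close>
  define step where "step x \<xi> = (SOME t. (fst (e \<xi>) \<in> \<Theta> \<longrightarrow> t \<in> U (fst (e \<xi>))) \<and> (\<forall>\<eta><\<xi>. x \<eta> < t))"
    for x :: "'k \<Rightarrow> 'k" and \<xi>
  define x where "x = wfrec {(\<eta>, \<xi>). \<eta> < \<xi>} step"
  have x_step: "x \<xi> = step x \<xi>" for \<xi>
  proof -
    have "x \<xi> = step (cut x {(\<eta>, \<xi>). \<eta> < \<xi>} \<xi>) \<xi>" unfolding x_def by (rule wfrec[OF wf])
    also have "\<dots> = step x \<xi>" by (simp add: step_def cut_apply)
    finally show ?thesis .
  qed
  have x: "(fst (e \<xi>) \<in> \<Theta> \<longrightarrow> x \<xi> \<in> U (fst (e \<xi>))) \<and> (\<forall>\<eta><\<xi>. x \<eta> < x \<xi>)" for \<xi>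
  proof -
    obtain b where b: "\<forall>\<eta><\<xi>. x \<eta> < b" using bounded_on_segment[OF reg, of \<xi> x] by blast
    have "\<exists>t. (fst (e \<xi>) \<in> \<Theta> \<longrightarrow> t \<in> U (fst (e \<xi>))) \<and> (\<forall>\<eta><\<xi>. x \<eta> < t)"
      using b U[of "fst (e \<xi>)" b] by (meson order.strict_trans)
    then show ?thesis unfolding x_step[of \<xi>] step_def by (rule someI_ex)
  qed
  have "inj x"
  proof (rule linorder_injI)
    fix \<eta> \<xi> :: 'k assume "\<eta> < \<xi>"
    then have "x \<eta> < x \<xi>" using x[of \<xi>] by blast
    then show "x \<eta> \<noteq> x \<xi>" by simp
  qed
  have "\<exists>\<tau>\<in>U \<theta>. snd (e (inv x \<tau>)) = j" if "\<theta> \<in> \<Theta>" for \<theta> j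
  proof -
    obtain \<xi> where \<xi>: "e \<xi> = (\<theta>, j)" using bij_betw_imp_surj_on[OF e] by (metis UNIV_I UNIV_Times_UNIV imageE)
    then have "x \<xi> \<in> U \<theta>" using x[of \<xi>] that by simp
    moreover have "snd (e (inv x (x \<xi>))) = j" using \<open>inj x\<close> \<xi> by simp
    ultimately show ?thesis by blast
  qed
  then show ?thesis by (intro exI[of _ "\<lambda>\<tau>. snd (e (inv x \<tau>))"]) blast
qed

text \<open>By uncountable cofinality, a tail of the accumulation points of
  \<open>c \<delta>\<close> is club in \<delta>. Coherence gives all of them the colour of \<delta>,
  and both stationary sets meet this club.\<close>

lemma coherent_not_both_stationary:
  assumes club: "club_in (c \<delta>) {..<\<delta>}" and coh: "\<delta> \<in> coherent_at c"
    and unc: "uncountable_cofinality {..<\<delta>}"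
    and A: "stationary_in A \<delta>" and B: "stationary_in B \<delta>"
  shows "\<exists>\<alpha>\<in>A. \<exists>\<beta>\<in>B. next_above (c \<alpha>) i = next_above (c \<beta>) i"
proof -
  have lim: "limit_of UNIV \<delta>" using coh by (simp add: coherent_at_def)
  have c: "c \<delta> \<subseteq> {..<\<delta>}" "\<And>x. x < \<delta> \<Longrightarrow> \<exists>y\<in>c \<delta>. x < y"
      "\<And>\<alpha>. \<alpha> < \<delta> \<Longrightarrow> limit_of (c \<delta>) \<alpha> \<Longrightarrow> \<alpha> \<in> c \<delta>"
    using club by (auto simp: club_in_iff)
  have "ord_zero < \<delta>" using lim by (simp add: limit_of_def)
  \<comment> \<open>The colour is frozen past the next element of \<open>c \<delta>\<close> above
    \<open>i\<close>; if there is none, \<open>ord_zero\<close> serves as threshold.\<close>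
  have "\<exists>m<\<delta>. \<forall>\<beta>>m. next_above (c \<delta>) i < \<beta> \<or> (\<forall>x\<in>c \<delta>. x \<le> i)"
  proof (cases "\<exists>x\<in>c \<delta>. i < x")
    case True
    then have "next_above (c \<delta>) i < \<delta>" using next_above(1) c(1) by blast
    then show ?thesis by blast
  next
    case False
    then show ?thesis using \<open>ord_zero < \<delta>\<close> by (meson not_le)
  qed
  then obtain m where m: "m < \<delta>" "\<And>\<beta>. m < \<beta> \<Longrightarrow> next_above (c \<delta>) i < \<beta> \<or> (\<forall>x\<in>c \<delta>. x \<le> i)" by blast
  let ?E = "{\<beta>\<in>accum (c \<delta>). m < \<beta>}"
  have "club_in ?E {..<\<delta>}"
    unfolding club_in_iff[OF lower_lessThan]
  proof (intro conjI ballI impI)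
    show "?E \<subseteq> {..<\<delta>}" using c(1) by (auto simp: accum_iff)
    fix x assume x: "x \<in> {..<\<delta>}"
    let ?R = "\<lambda>x z. \<exists>y\<in>c \<delta>. x < y \<and> y < z"
    have "\<exists>z\<in>{..<\<delta>}. ?R x z" if x: "x \<in> {..<\<delta>}" for x
    proof -
      obtain y where y: "y \<in> c \<delta>" "x < y" using c(2)[of x] x by blast
      then obtain z where "y < z" "z < \<delta>" using limit_of_less[OF lim, of y] c(1) by blast
      then show ?thesis using y by blast
    qed
    moreover have "?R x z" if "x \<le> y" "?R y z" for x y z using that le_less_trans by blast
    moreover have "x < z" if "?R x z" for x z using that order.strict_trans by blast
    moreover have "max x m \<in> {..<\<delta>}" using x m(1) by simp
    ultimately have "\<exists>\<gamma>\<in>{..<\<delta>}. max x m < \<gamma> \<and> (\<forall>x<\<gamma>. \<exists>z<\<gamma>. ?R x z)"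
      by (rule closure_point[OF unc lower_lessThan])
    then obtain \<gamma> where \<gamma>: "\<gamma> < \<delta>" "max x m < \<gamma>" "\<forall>x<\<gamma>. \<exists>z<\<gamma>. ?R x z" by blast
    have "limit_of (c \<delta>) \<gamma>" by (rule limit_ofI[OF \<gamma>(2)]) (use \<gamma>(3) order.strict_trans in blast)
    then show "\<exists>\<gamma>\<in>?E. x < \<gamma>" using \<gamma>(1,2) c(3) by (intro bexI[of _ \<gamma>]) (auto simp: accum_iff)
  next
    fix \<alpha> assume \<alpha>: "\<alpha> \<in> {..<\<delta>}" "limit_of ?E \<alpha>"
    then have "limit_of (c \<delta>) \<alpha>" using limit_of_mono[OF \<alpha>(2)] by (auto simp: accum_iff)
    moreover have "\<exists>\<beta>\<in>?E. ord_zero < \<beta> \<and> \<beta> < \<alpha>" using \<alpha>(2) unfolding limit_of_def by blast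
    ultimately show "\<alpha> \<in> ?E" using c(3) \<alpha>(1) by (auto simp: accum_iff)
  qed
  then obtain \<alpha> \<beta> where "\<alpha> \<in> A \<inter> ?E" "\<beta> \<in> B \<inter> ?E" using A B unfolding stationary_in_def by blast
  then show ?thesis using next_above_coherent[OF coh, of _ i] m(2) by (metis (no_types, lifting) Int_iff mem_Collect_eq)
qed

section \<open>Coherence at points of cofinality at least \<chi>\<close>

lemma le_on_less_segmentD:
  assumes "le_on C <o le_on {..<\<chi>}"
  shows "\<exists>\<mu><\<chi>. \<exists>f. bij_betw f {..<\<mu>} C"
proof -
  have WO: "Well_order (le_on {..<\<chi>})" "Well_order (le_on C)"
    using assms by (auto simp: ordLess_def)
  then obtain \<mu> where \<mu>: "\<mu> < \<chi>" "le_on C =o Restr (le_on {..<\<chi>}) (underS (le_on {..<\<chi>}) \<mu>)"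
    using assms ordLess_iff_ordIso_Restr[OF WO] by auto
  have seg: "underS (le_on {..<\<chi>}) \<mu> = {..<\<mu>}" using \<mu>(1) by (auto simp: underS_def le_on_def)
  have restr: "Restr (le_on {..<\<chi>}) {..<\<mu>} = le_on {..<\<mu>}"
    using \<mu>(1) by (auto simp: le_on_def)
  have "le_on C =o le_on {..<\<mu>}" using \<mu>(2) unfolding seg restr .
  then obtain f where "iso (le_on C) (le_on {..<\<mu>}) f" unfolding ordIso_def by blast
  then have "bij_betw f C {..<\<mu>}" by (simp add: iso_def)
  then show ?thesis using bij_betw_inv \<mu>(1) by blast
qed

lemma cofinal_segment_map_ge_cf:
  assumes "f ` {..<\<theta>} \<subseteq> {..<\<alpha>}" "\<And>\<beta>. \<beta> < \<alpha> \<Longrightarrow> \<exists>i<\<theta>. \<beta> \<le> f i"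
  shows "cf \<alpha> \<le> \<theta>"
  unfolding cf_def by (rule Least_le) (use assms in blast)

text \<open>The injection \<open>e\<close> moves the index set \<open>nat\<close> into \<omega>, so
  an unbounded sequence would give \<open>cf \<delta> \<le> ord_omega\<close>. The infinite segment
  below \<open>x\<close> guarantees that the least element defining \<open>ord_omega\<close>
  exists.\<close>

lemma uncountable_cofinality_of_cf:
  assumes "infinite {..<x :: 'k::wellorder}" "ord_omega < cf (\<delta> :: 'k)"
  shows "uncountable_cofinality {..<\<delta>}"
  unfolding uncountable_cofinality_def
proof (intro allI impI)
  fix f :: "nat \<Rightarrow> 'k" assume f: "range f \<subseteq> {..<\<delta>}"
  have "infinite {..<ord_omega :: 'k}" unfolding ord_omega_def by (rule LeastI) (rule assms(1))
  then obtain e :: "nat \<Rightarrow> 'k" where e: "inj e" "range e \<subseteq> {..<ord_omega}"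
    using infinite_countable_subset by blast
  have "\<exists>\<beta><\<delta>. \<forall>i < ord_omega. f (inv e i) < \<beta>"
  proof (rule ccontr)
    assume "\<not> ?thesis"
    then have "\<exists>i < ord_omega. \<beta> \<le> f (inv e i)" if "\<beta> < \<delta>" for \<beta> using that by (meson not_le)
    moreover have "(\<lambda>i. f (inv e i)) ` {..<ord_omega} \<subseteq> {..<\<delta>}" using f by blast
    ultimately have "cf \<delta> \<le> ord_omega" by (intro cofinal_segment_map_ge_cf)
    then show False using assms(2) by simp
  qed
  then obtain \<beta> where "\<beta> < \<delta>" "\<forall>i < ord_omega. f (inv e i) < \<beta>" by blast
  moreover have "f n = f (inv e (e n))" for n using e(1) by simp
  ultimately show "\<exists>b\<in>{..<\<delta>}. \<forall>n. f n < b" using e(2) by (metis lessThan_iff rangeI subsetD)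
qed

text \<open>Like the condition on the order type in \<open>init_seg_mod\<close>, this speaks about sequences of length below
  \<open>\<chi>\<close>, so that no computation of \<open>cf\<close> at the top of a closed copy is needed.\<close>

definition cofinality_ge :: "'k::wellorder \<Rightarrow> 'k \<Rightarrow> bool" where
  "cofinality_ge \<chi> \<delta> \<longleftrightarrow> (\<forall>\<mu><\<chi>. \<forall>f. (\<forall>\<eta><\<mu>. f \<eta> < \<delta>) \<longrightarrow> (\<exists>b<\<delta>. \<forall>\<eta><\<mu>. f \<eta> < b))"

text \<open>The exception in \<open>init_seg_mod\<close> would enumerate the cofinal set
  \<open>c \<delta>\<close> in fewer than \<chi> steps, which \<open>cofinality_ge\<close> forbids.
  So \<open>c \<beta>\<close> is an initial segment of \<open>c \<delta>\<close>; being unbounded in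
  \<beta> while \<beta> lies in \<open>c \<delta>\<close>, it is cut exactly at \<beta>.\<close>

lemma cofinality_ge_coherent:
  assumes sq: "square_sequence \<chi> \<C>" and lim: "limit_of UNIV \<delta>" and long: "cofinality_ge \<chi> \<delta>"
  shows "\<delta> \<in> coherent_at (\<lambda>\<delta>. the_elem (\<C> \<delta>))"
proof -
  let ?c = "\<lambda>\<delta>. the_elem (\<C> \<delta>)"
  have C: "\<C> \<beta> = {?c \<beta>} \<and> club_in (?c \<beta>) {..<\<beta>}" if "limit_of UNIV \<beta>" for \<beta>
    using sq that unfolding square_sequence_def by (metis accum_iff UNIV_I the_elem_eq)
  have c: "?c \<delta> \<subseteq> {..<\<delta>}" "\<And>x. x < \<delta> \<Longrightarrow> \<exists>y\<in>?c \<delta>. x < y" using C[OF lim] by (auto simp: club_in_iff)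
  have not_short: "\<not> le_on (?c \<delta>) <o le_on {..<\<chi>}"
  proof
    assume "le_on (?c \<delta>) <o le_on {..<\<chi>}"
    then obtain \<mu> f where \<mu>: "\<mu> < \<chi>" "bij_betw f {..<\<mu>} (?c \<delta>)" using le_on_less_segmentD by blast
    have im: "f ` {..<\<mu>} = ?c \<delta>" using \<mu>(2) by (rule bij_betw_imp_surj_on)
    then have "\<forall>\<eta><\<mu>. f \<eta> < \<delta>" using c(1) by auto
    then obtain b where b: "b < \<delta>" "\<forall>\<eta><\<mu>. f \<eta> < b" using long \<mu>(1) unfolding cofinality_ge_def by blast
    obtain y where "y \<in> ?c \<delta>" "b < y" using c(2) b(1) by blast
    then show False using b(2) im by force
  qed
  have "?c \<beta> = ?c \<delta> \<inter> {..<\<beta>}" if \<beta>: "\<beta> \<in> accum (?c \<delta>)" for \<beta>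
  proof -
    have lim\<beta>: "limit_of UNIV \<beta>" "limit_of (?c \<delta>) \<beta>" "\<beta> \<in> ?c \<delta>"
      using \<beta> limit_of_mono by (auto simp: accum_iff)
    have c\<beta>: "?c \<beta> \<subseteq> {..<\<beta>}" "\<And>x. x < \<beta> \<Longrightarrow> \<exists>y\<in>?c \<beta>. x < y"
      using C[OF lim\<beta>(1)] by (auto simp: club_in_iff)
    have "\<forall>\<alpha>. \<forall>C\<in>\<C> \<alpha>. \<forall>\<beta>\<in>accum C. \<exists>D\<in>\<C> \<beta>. init_seg_mod \<chi> D C"
      using sq unfolding square_sequence_def by (elim conjE)
    moreover have "?c \<delta> \<in> \<C> \<delta>" using C[OF lim] by auto
    ultimately have "\<exists>D\<in>\<C> \<beta>. init_seg_mod \<chi> D (?c \<delta>)" using \<beta> by blast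
    then obtain D where "D \<in> \<C> \<beta>" "init_seg D (?c \<delta>)" using not_short by (auto simp: init_seg_mod_def)
    moreover have "D = ?c \<beta>" using \<open>D \<in> \<C> \<beta>\<close> C[OF lim\<beta>(1)] by blast
    ultimately have "init_seg (?c \<beta>) (?c \<delta>)" by simp
    then consider "?c \<beta> = ?c \<delta>" | b where "?c \<beta> = ?c \<delta> \<inter> {..<b}" unfolding init_seg_def by blast
    then show ?thesis
    proof cases
      case 1
      then show ?thesis using lim\<beta>(3) c\<beta>(1) by auto
    next
      case 2
      have "\<beta> \<notin> ?c \<delta> \<inter> {..<b}" unfolding 2[symmetric] using c\<beta>(1) by blast
      then have "b \<le> \<beta>" using lim\<beta>(3) by auto
      moreover have "\<not> b < \<beta>"
      proof
        assume "b < \<beta>"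
        then have "\<exists>y\<in>?c \<delta> \<inter> {..<b}. b < y" unfolding 2[symmetric] by (rule c\<beta>(2))
        then show False by auto
      qed
      ultimately have "b = \<beta>" by simp
      then show ?thesis using 2 by (rule subst)
    qed
  qed
  then show ?thesis using lim by (simp add: coherent_at_def)
qed

lemma closed_copy_top_limit:
  assumes "infinite_regular {..<\<theta>}" "closed_copy \<theta> \<pi> X"
  shows "limit_of UNIV (\<pi> \<theta>)"
proof -
  have lim: "limit_of UNIV \<theta>" by (rule infinite_regular_limit[OF assms(1)])
  then have "ord_zero < \<theta>" by (simp add: limit_of_def)
  then have "\<pi> ord_zero < \<pi> \<theta>" using closed_copy_less[OF assms(2)] by blast
  then show ?thesis
  proof (rule limit_ofI)
    fix x assume "x < \<pi> \<theta>"
    then obtain \<eta> where "\<eta> < \<theta>" "x < \<pi> \<eta>" using closed_copy_cofinal[OF assms(2) order.refl lim] by blast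
    then show "\<exists>y\<in>UNIV. x < y \<and> y < \<pi> \<theta>" using closed_copy_less[OF assms(2)] by blast
  qed
qed

lemma cofinality_ge_top:
  assumes "infinite_regular {..<\<theta>}" "closed_copy \<theta> \<pi> X" "\<chi> \<le> \<theta>"
  shows "cofinality_ge \<chi> (\<pi> \<theta>)"
  unfolding cofinality_ge_def
proof (intro allI impI)
  fix \<mu> f assume "\<mu> < \<chi>" and f: "\<forall>\<eta><\<mu>. f \<eta> < \<pi> \<theta>"
  then have "\<mu> < \<theta>" using assms(3) by simp
  then show "\<exists>b<\<pi> \<theta>. \<forall>\<eta><\<mu>. f \<eta> < b" using closed_copy_bounded[OF assms(1,2)] f by blast
qed

text \<open>Provides coherence for clause (2), as \<open>cofinality_ge_top\<close> does for the
  fatness of the classes.\<close>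

lemma cofinality_ge_of_cf:
  assumes "\<chi> \<le> cf \<delta>"
  shows "cofinality_ge \<chi> \<delta>"
  unfolding cofinality_ge_def
proof (intro allI impI, rule ccontr)
  fix \<mu> f assume \<mu>: "\<mu> < \<chi>" and f: "\<forall>\<eta><\<mu>. f \<eta> < \<delta>" and "\<not> (\<exists>b<\<delta>. \<forall>\<eta><\<mu>. f \<eta> < b)"
  then have "\<exists>\<eta><\<mu>. \<beta> \<le> f \<eta>" if "\<beta> < \<delta>" for \<beta> using that by (meson not_le)
  moreover have "f ` {..<\<mu>} \<subseteq> {..<\<delta>}" using f by auto
  ultimately have "cf \<delta> \<le> \<mu>" by (intro cofinal_segment_map_ge_cf)
  then show False using \<mu> assms by simp
qed

text \<open>A bound for a constant sequence shows that \<delta> is no successor; zero satisfies the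
  cofinality condition vacuously and is excluded separately.\<close>

lemma limit_of_uncountable_cofinality:
  assumes "uncountable_cofinality {..<\<delta>}" "ord_zero < \<delta>"
  shows "limit_of UNIV \<delta>"
proof (rule limit_ofI[OF assms(2)])
  fix x assume "x < \<delta>"
  then have "range (\<lambda>n::nat. x) \<subseteq> {..<\<delta>}" by simp
  then show "\<exists>y\<in>UNIV. x < y \<and> y < \<delta>"
    using assms(1) unfolding uncountable_cofinality_def by (meson UNIV_I lessThan_iff)
qed

theorem theorem1p24:
  fixes \<chi> :: "'k::wellorder" and F :: "'k set"
  assumes "infinite_regular (UNIV :: 'k set)" and "uncountable (UNIV :: 'k set)"
    and "infinite_regular {..<\<chi>}"
    and "square_principle \<chi>"
    and "fat F"
  shows "\<exists>Fs :: 'k \<Rightarrow> 'k set.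
    disjoint_family Fs \<and> (\<Union>j. Fs j) = F \<and>
    (\<forall>j. fat (Fs j)) \<and>
    (\<forall>J. \<not> (\<exists>\<delta>\<in>E_ge \<chi>. ord_omega < cf \<delta> \<and>
        stationary_in ((\<Union>j\<in>J. Fs j) \<inter> {..<\<delta>}) \<delta> \<and>
        stationary_in ((\<Union>j\<in>UNIV - J. Fs j) \<inter> {..<\<delta>}) \<delta>))"
proof -
  note reg = assms(1) and unc = assms(2)
  obtain \<C> where sq: "square_sequence \<chi> \<C>" using assms(4) unfolding square_principle_def by blast
  define c where "c \<delta> = the_elem (\<C> \<delta>)" for \<delta>
  have \<C>: "\<C> \<delta> = {c \<delta>} \<and> club_in (c \<delta>) {..<\<delta>}" if "limit_of UNIV \<delta>" for \<delta>
    using sq that unfolding square_sequence_def c_def by (metis accum_iff UNIV_I the_elem_eq)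
  then have club: "\<And>\<delta>. limit_of UNIV \<delta> \<Longrightarrow> club_in (c \<delta>) {..<\<delta>}" by blast
  have no_thread: "\<exists>\<alpha>. limit_of A \<alpha> \<and> c \<alpha> \<noteq> A \<inter> {..<\<alpha>}" if A: "\<And>x. \<exists>a\<in>A. x < a" for A
  proof -
    have "cofinal A (le_on UNIV)" using A by (simp add: cofinal_le_on_iff)
    moreover have "\<forall>A. cofinal A (le_on UNIV) \<longrightarrow> (\<exists>\<alpha>\<in>accum_plus A. A \<inter> {..<\<alpha>} \<notin> \<C> \<alpha>)"
      using sq unfolding square_sequence_def by (elim conjE)
    ultimately have "\<exists>\<alpha>\<in>accum_plus A. A \<inter> {..<\<alpha>} \<notin> \<C> \<alpha>" by blast
    then obtain \<alpha> where "\<alpha> \<in> accum_plus A" "A \<inter> {..<\<alpha>} \<notin> \<C> \<alpha>" by blast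
    moreover from this have "limit_of A \<alpha>" by (auto simp: accum_plus_def limit_of_iff)
    moreover from this have "limit_of UNIV \<alpha>" using limit_of_mono by blast
    ultimately show ?thesis using \<C> by (metis singletonI)
  qed
  have coherent: "\<delta> \<in> coherent_at c" if "limit_of UNIV \<delta>" "cofinality_ge \<chi> \<delta>" for \<delta>
    using cofinality_ge_coherent[OF sq that] by (simp add: c_def[abs_def])
  \<comment> \<open>For \<open>\<theta> \<ge> \<chi>\<close> the tops of copies are points of exact
    coherence.\<close>
  define \<Theta> where "\<Theta> = {\<theta>. infinite_regular {..<\<theta>} \<and> \<chi> \<le> \<theta>}"
  have ne: "\<Theta> \<noteq> {}" using assms(3) by (auto simp: \<Theta>_def)
  have stat: "stationary (tops \<theta> F)" if "\<theta> \<in> \<Theta>" for \<theta>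
    using fat_stationary_tops[OF assms(5)] that by (simp add: \<Theta>_def)
  have coh: "tops \<theta> F \<subseteq> coherent_at c" if "\<theta> \<in> \<Theta>" for \<theta>
    using that coherent closed_copy_top_limit cofinality_ge_top unfolding tops_def \<Theta>_def by blast
  have "\<exists>i. \<forall>\<theta>\<in>\<Theta>. \<forall>b. \<exists>\<tau>>b. \<exists>\<theta>'\<in>\<Theta>. \<theta> \<le> \<theta>' \<and> stationary {\<delta>\<in>tops \<theta>' F. next_above (c \<delta>) i = \<tau>}"
    by (rule exists_separating_index[OF reg unc]) (fact club no_thread ne stat coh)+
  then obtain i where i: "\<And>\<theta> b. \<theta> \<in> \<Theta> \<Longrightarrow>
      \<exists>\<tau>>b. \<exists>\<theta>'\<in>\<Theta>. \<theta> \<le> \<theta>' \<and> stationary {\<delta>\<in>tops \<theta>' F. next_above (c \<delta>) i = \<tau>}" by blast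
  \<comment> \<open>Colours stationary for a larger \<open>\<theta>'\<close> count as well, since
    its copies restrict to copies of \<theta>.\<close>
  define U where "U \<theta> = {\<tau>. \<exists>\<theta>'\<in>\<Theta>. \<theta> \<le> \<theta>' \<and> stationary {\<delta>\<in>tops \<theta>' F. next_above (c \<delta>) i = \<tau>}}" for \<theta>
  have "\<exists>\<tau>\<in>U \<theta>. b < \<tau>" if "\<theta> \<in> \<Theta>" for \<theta> b using i[OF that] unfolding U_def by blast
  then have "\<exists>p :: 'k \<Rightarrow> 'k. \<forall>\<theta>\<in>\<Theta>. \<forall>j. \<exists>\<tau>\<in>U \<theta>. p \<tau> = j"
    by (rule colouring_onto_on_unbounded[OF reg])
  then obtain p :: "'k \<Rightarrow> 'k" where p: "\<And>\<theta> j. \<theta> \<in> \<Theta> \<Longrightarrow> \<exists>\<tau>\<in>U \<theta>. p \<tau> = j" by blast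
  \<comment> \<open>Through \<open>p\<close>, every class receives a colour from each
    \<open>U \<theta>\<close> with \<theta> in \<Theta>.\<close>
  define Fs where "Fs j = {\<delta>\<in>F. p (next_above (c \<delta>) i) = j}" for j
  have "disjoint_family Fs" by (auto simp: disjoint_family_on_def Fs_def)
  moreover have "(\<Union>j. Fs j) = F" by (auto simp: Fs_def)
  moreover have "fat (Fs j)" for j
    unfolding fat_iff
  proof (intro allI impI)
    fix D :: "'k set" and \<theta> :: 'k assume D: "club_in D UNIV" and \<theta>: "infinite_regular {..<\<theta>}"
    \<comment> \<open>For \<theta> below \<chi>, the copy is found for a cardinal at least \<chi>
      and then cut at \<theta>.\<close>
    have "max \<theta> \<chi> \<in> \<Theta>" using \<theta> assms(3) by (auto simp: \<Theta>_def max_def)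
    then obtain \<tau> where \<tau>: "\<tau> \<in> U (max \<theta> \<chi>)" "p \<tau> = j" using p by blast
    then obtain \<theta>' where \<theta>': "\<theta>' \<in> \<Theta>" "max \<theta> \<chi> \<le> \<theta>'"
      "stationary {\<delta>\<in>tops \<theta>' F. next_above (c \<delta>) i = \<tau>}" unfolding U_def by blast
    then have "infinite_regular {..<\<theta>'}" by (simp add: \<Theta>_def)
    then have "\<exists>\<pi>. closed_copy \<theta>' \<pi> ({\<delta>\<in>F. next_above (c \<delta>) i = \<tau>} \<inter> D)"
      using closed_copy_in_fibre[OF reg unc, of c] club coh[OF \<theta>'(1)] \<theta>'(3) D by blast
    then obtain \<pi> where \<pi>: "closed_copy \<theta>' \<pi> ({\<delta>\<in>F. next_above (c \<delta>) i = \<tau>} \<inter> D)" by blast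
    have "closed_copy \<theta> \<pi> (Fs j \<inter> D)"
      by (rule closed_copy_mono[OF \<pi>]) (use \<theta>'(2) \<tau>(2) in \<open>auto simp: Fs_def\<close>)
    then show "\<exists>\<pi>. closed_copy \<theta> \<pi> (Fs j \<inter> D)" by blast
  qed
  moreover have False
    if \<delta>: "\<delta> \<in> E_ge \<chi>" "ord_omega < cf \<delta>"
      and J: "stationary_in ((\<Union>j\<in>J. Fs j) \<inter> {..<\<delta>}) \<delta>"
      and J': "stationary_in ((\<Union>j\<in>UNIV - J. Fs j) \<inter> {..<\<delta>}) \<delta>" for J \<delta>
  proof -
    have "infinite {..<\<chi>}" using assms(3) by (simp add: infinite_regular_def)
    then have uncof: "uncountable_cofinality {..<\<delta>}"
      using \<delta>(2) by (rule uncountable_cofinality_of_cf)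
    have "\<delta> \<noteq> ord_zero"
    proof
      assume "\<delta> = ord_zero"
      then have none: "\<not> \<beta> < \<delta>" for \<beta> using ord_zero_le[of \<beta>] by simp
      have "cf \<delta> \<le> ord_zero" by (rule cofinal_segment_map_ge_cf[of id]) (use none \<open>\<delta> = ord_zero\<close> in auto)
      then show False using \<delta>(2) ord_zero_le[of "ord_omega :: 'k"] by simp
    qed
    then have lim: "limit_of UNIV \<delta>"
      using limit_of_uncountable_cofinality[OF uncof] ord_zero_le[of \<delta>] by simp
    have "cofinality_ge \<chi> \<delta>" using \<delta>(1) cofinality_ge_of_cf by (simp add: E_ge_def)
    then have "\<delta> \<in> coherent_at c" by (rule coherent[OF lim])
    \<comment> \<open>Points of equal colour lie in the same class, yet one class index is in
      \<open>J\<close> and the other is not.\<close>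
    from coherent_not_both_stationary[OF club[OF lim] this uncof J J', of i]
    show False by (auto simp: Fs_def)
  qed
  ultimately show ?thesis by blast
qed

end
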